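(* Let $n\ge 2$ and let $\varphi:\Delta_n\to\mathbb{R}$ be a smooth exponentially concave function such that the Euclidean Hessian of $e^{\varphi}$ is strictly negative definite everywhere on $\Delta_n$. Let $(g,\nabla,\nabla^* )$ be the geometric structure on $\Delta_n$ induced by the L-divergence of $\varphi$. Then the primal connection $\nabla$ and the dual connection $\nabla^*$ have constant sectional curvature $-1$ with respect to $g$. In particular, the primal and dual Ricci curvatures satisfy the Einstein condition $$\mathrm{Ric}=\mathrm{Ric}^*=-(n-2)g.$$
   Context: $\Delta_n=\{p\in\mathbb{R}^n: p_i>0,\ \sum_{i=1}^n p_i=1\}$, a smooth $(n-1)$-dimensional manifold. $\nabla\varphi(p)\cdot v$ denotes the directional derivative of $\varphi$ at $p$ along $v\in\mathbb{R}^n$ with $\sum_i v_i=0$; definiteness of the Hessian is with respect to nonzero such $v$. $\varphi$ is exponentially concave if $e^{\varphi}$ is concave. L-divergence: $T(q\mid p)=\log(1+\nabla\varphi(p)\cdot(q-p))-(\varphi(q)-\varphi(p))$. Geometric structure: in any coordinate system $\xi$ of $\Delta_n$, $g_{ij}(\xi)=-\partial_{\xi_i}\partial_{\xi'_j}T(\xi\mid\xi')|_{\xi=\xi'}$; primal connection $\nabla$: $\Gamma_{ijk}(\xi)=-\partial_{\xi_i}\partial_{\xi_j}\partial_{\xi'_k}T(\xi\mid\xi')|_{\xi=\xi'}$; dual connection $\nabla^*$: $\Gamma^*_{ijk}(\xi)=-\partial_{\xi_k}\partial_{\xi'_i}\partial_{\xi'_j}T(\xi\mid\xi')|_{\xi=\xi'}$;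 $\nabla_{\partial_i}\partial_j=\sum_k\Gamma_{ij}^k\partial_k$ with $\Gamma_{ij}^k=\sum_m\Gamma_{ijm}g^{mk}$, and similarly for $\nabla^*$. Curvature: $R(X,Y)Z=\nabla_X\nabla_YZ-\nabla_Y\nabla_XZ-\nabla_{[X,Y]}Z$. A connection has constant sectional curvature $k$ with respect to $g$ if $R(X,Y)Z=k(\langle Y,Z\rangle X-\langle X,Z\rangle Y)$ for all smooth vector fields $X,Y,Z$. The Ricci curvature is the trace $\mathrm{Ric}(Y,Z)=\mathrm{tr}(X\mapsto R(X,Y)Z)$; $\mathrm{Ric}$ and $\mathrm{Ric}^*$ are those of $\nabla$ and $\nabla^*$. *)

theory Defs
  imports "HOL-Analysis.Analysis"
begin

section \<open>Smooth maps\<close>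

primrec Ck_on :: "nat \<Rightarrow> ('a::real_normed_vector \<Rightarrow> 'b::real_normed_vector) \<Rightarrow> 'a set \<Rightarrow> bool" where
  "Ck_on 0 f W \<longleftrightarrow> continuous_on W f"
| "Ck_on (Suc k) f W \<longleftrightarrow>
     f differentiable_on W \<and> (\<forall>v. Ck_on k (\<lambda>x. frechet_derivative f (at x) v) W)"

text \<open>\<^const>\<open>Ck_on\<close> is meant for open sets only. On an arbitrary subset of a normed space (such as
  the open simplex, which has empty interior), smoothness means that the map extends locally to a
  smooth map on an ambient open set. For open sets this is the usual notion.\<close>

definition smooth_on :: "'a::real_normed_vector set \<Rightarrow> ('a \<Rightarrow> 'b::real_normed_vector) \<Rightarrow> bool" where
  "smooth_on S f \<longleftrightarrow>
     (\<forall>p\<in>S. \<exists>W F. open W \<and> p \<in> W \<and> (\<forall>k. Ck_on k F W) \<and> (\<forall>q\<in>W \<inter> S. F q = f q))"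

text \<open>The two-sided derivative of \<open>f\<close> at \<open>p\<close> along \<open>v\<close>. For \<open>p\<close> in the open simplex and \<open>v\<close> with
  vanishing coordinate sum it only depends on the values of \<open>f\<close> on the simplex.\<close>

definition dirderiv :: "('a::real_normed_vector \<Rightarrow> real) \<Rightarrow> 'a \<Rightarrow> 'a \<Rightarrow> real" where
  "dirderiv f p v = deriv (\<lambda>t. f (p + t *\<^sub>R v)) 0"

abbreviation pderiv_at :: "'m::finite \<Rightarrow> (real^'m \<Rightarrow> real) \<Rightarrow> real^'m \<Rightarrow> real" where
  "pderiv_at i f u \<equiv> dirderiv f u (axis i 1)"


section \<open>The open simplex and the L-divergence\<close>

definition prob_simplex :: "(real^'n) set" where
  "prob_simplex = {p. (\<forall>i. 0 < p $ i) \<and> (\<Sum>i\<in>UNIV. p $ i) = 1}"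

definition exponentially_concave :: "(real^'n \<Rightarrow> real) \<Rightarrow> bool" where
  "exponentially_concave \<phi> \<longleftrightarrow> concave_on prob_simplex (\<lambda>p. exp (\<phi> p))"

definition hessian :: "(real^'n \<Rightarrow> real) \<Rightarrow> real^'n \<Rightarrow> real^'n \<Rightarrow> real^'n \<Rightarrow> real" where
  "hessian f p v w = dirderiv (\<lambda>q. dirderiv f q w) p v"

definition neg_definite_hessian :: "(real^'n \<Rightarrow> real) \<Rightarrow> bool" where
  "neg_definite_hessian f \<longleftrightarrow>
     (\<forall>p\<in>prob_simplex. \<forall>v. (\<Sum>i\<in>UNIV. v $ i) = 0 \<and> v \<noteq> 0 \<longrightarrow> hessian f p v v < 0)"

text \<open>\<open>L_divergence \<phi> q p\<close> stands for $T(q \mid p)$.\<close>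

definition L_divergence :: "(real^'n \<Rightarrow> real) \<Rightarrow> real^'n \<Rightarrow> real^'n \<Rightarrow> real" where
  "L_divergence \<phi> q p = ln (1 + dirderiv \<phi> p (q - p)) - (\<phi> q - \<phi> p)"


section \<open>Coordinate systems\<close>

text \<open>\<open>\<xi>\<close> is a coordinate map from a (relatively) open part \<open>V\<close> of the simplex onto an open set \<open>U\<close>,
  and \<open>x\<close> is its inverse. Everything below is written in such coordinates: a vector field on \<open>V\<close> is
  given by its component function on \<open>U\<close>. The choice \<open>V = prob_simplex\<close> is possible, so that global
  vector fields are covered.\<close>

definition coordinate_system ::
    "(real^'n) set \<Rightarrow> (real^'m) set \<Rightarrow> (real^'n \<Rightarrow> real^'m) \<Rightarrow> (real^'m \<Rightarrow> real^'n) \<Rightarrow> bool" where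
  "coordinate_system V U \<xi> x \<longleftrightarrow>
     openin (top_of_set prob_simplex) V \<and> open U \<and> homeomorphism V U \<xi> x \<and>
     smooth_on V \<xi> \<and> smooth_on U x"

definition coord_divergence ::
    "(real^'n \<Rightarrow> real) \<Rightarrow> (real^'m \<Rightarrow> real^'n) \<Rightarrow> real^'m \<Rightarrow> real^'m \<Rightarrow> real" where
  "coord_divergence \<phi> x u u' = L_divergence \<phi> (x u) (x u')"


section \<open>The geometric structure induced by a divergence\<close>

text \<open>In the next three definitions unprimed variables refer to the first and primed variables to
  the second argument of the divergence \<open>T\<close>; after differentiation both are set equal to \<open>u\<close>.\<close>

definition metric_coeff ::
    "(real^'m \<Rightarrow> real^'m \<Rightarrow> real) \<Rightarrow> real^'m \<Rightarrow> 'm::finite \<Rightarrow> 'm \<Rightarrow> real" where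
  "metric_coeff T u i j =
     - pderiv_at i (\<lambda>a. pderiv_at j (\<lambda>a'. T a a') u) u"

definition primal_coeff ::
    "(real^'m \<Rightarrow> real^'m \<Rightarrow> real) \<Rightarrow> real^'m \<Rightarrow> 'm::finite \<Rightarrow> 'm \<Rightarrow> 'm \<Rightarrow> real" where
  "primal_coeff T u i j k =
     - pderiv_at i (\<lambda>a. pderiv_at j (\<lambda>b. pderiv_at k (\<lambda>a'. T b a') u) a) u"

definition dual_coeff ::
    "(real^'m \<Rightarrow> real^'m \<Rightarrow> real) \<Rightarrow> real^'m \<Rightarrow> 'm::finite \<Rightarrow> 'm \<Rightarrow> 'm \<Rightarrow> real" where
  "dual_coeff T u i j k =
     - pderiv_at k (\<lambda>a. pderiv_at i (\<lambda>a'. pderiv_at j (\<lambda>b'. T a b') a') u) u"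

definition inverse_metric_coeff ::
    "(real^'m \<Rightarrow> real^'m \<Rightarrow> real) \<Rightarrow> real^'m \<Rightarrow> 'm::finite \<Rightarrow> 'm \<Rightarrow> real" where
  "inverse_metric_coeff T u i j = matrix_inv (\<chi> k l. metric_coeff T u k l) $ i $ j"

definition primal_christoffel ::
    "(real^'m \<Rightarrow> real^'m \<Rightarrow> real) \<Rightarrow> real^'m \<Rightarrow> 'm::finite \<Rightarrow> 'm \<Rightarrow> 'm \<Rightarrow> real" where
  "primal_christoffel T u i j k =
     (\<Sum>m\<in>UNIV. primal_coeff T u i j m * inverse_metric_coeff T u m k)"

definition dual_christoffel ::
    "(real^'m \<Rightarrow> real^'m \<Rightarrow> real) \<Rightarrow> real^'m \<Rightarrow> 'm::finite \<Rightarrow> 'm \<Rightarrow> 'm \<Rightarrow> real" where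
  "dual_christoffel T u i j k =
     (\<Sum>m\<in>UNIV. dual_coeff T u i j m * inverse_metric_coeff T u m k)"


section \<open>Curvature\<close>

type_synonym 'm vfield = "real^'m \<Rightarrow> real^'m"

definition metric_form ::
    "(real^'m \<Rightarrow> real^'m \<Rightarrow> real) \<Rightarrow> 'm::finite vfield \<Rightarrow> 'm vfield \<Rightarrow> real^'m \<Rightarrow> real" where
  "metric_form T X Y u = (\<Sum>i\<in>UNIV. \<Sum>j\<in>UNIV. metric_coeff T u i j * X u $ i * Y u $ j)"

text \<open>The connection with $\nabla_{\partial_i}\partial_j = \sum_k \Gamma_{ij}^k \partial_k$, where
  \<open>\<Gamma> u i j k\<close> stands for $\Gamma_{ij}^k(u)$.\<close>

definition covariant_deriv ::
    "(real^'m \<Rightarrow> 'm \<Rightarrow> 'm \<Rightarrow> 'm \<Rightarrow> real) \<Rightarrow> 'm::finite vfield \<Rightarrow> 'm vfield \<Rightarrow> 'm vfield" where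
  "covariant_deriv \<Gamma> X Y u =
     (\<chi> k. \<Sum>i\<in>UNIV. X u $ i *
        (pderiv_at i (\<lambda>a. Y a $ k) u + (\<Sum>j\<in>UNIV. \<Gamma> u i j k * Y u $ j)))"

definition lie_bracket :: "'m::finite vfield \<Rightarrow> 'm vfield \<Rightarrow> 'm vfield" where
  "lie_bracket X Y u =
     (\<chi> k. \<Sum>i\<in>UNIV. X u $ i * pderiv_at i (\<lambda>a. Y a $ k) u - Y u $ i * pderiv_at i (\<lambda>a. X a $ k) u)"

definition curvature ::
    "(real^'m \<Rightarrow> 'm \<Rightarrow> 'm \<Rightarrow> 'm \<Rightarrow> real) \<Rightarrow>
      'm::finite vfield \<Rightarrow> 'm vfield \<Rightarrow> 'm vfield \<Rightarrow> 'm vfield" where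
  "curvature \<Gamma> X Y Z u =
     covariant_deriv \<Gamma> X (covariant_deriv \<Gamma> Y Z) u - covariant_deriv \<Gamma> Y (covariant_deriv \<Gamma> X Z) u
       - covariant_deriv \<Gamma> (lie_bracket X Y) Z u"

definition constant_sectional_curvature ::
    "(real^'m) set \<Rightarrow> (real^'m \<Rightarrow> real^'m \<Rightarrow> real) \<Rightarrow>
      (real^'m \<Rightarrow> 'm \<Rightarrow> 'm \<Rightarrow> 'm \<Rightarrow> real) \<Rightarrow> real \<Rightarrow> bool" where
  "constant_sectional_curvature U T \<Gamma> c \<longleftrightarrow>
     (\<forall>X Y Z. smooth_on U X \<and> smooth_on U Y \<and> smooth_on U Z \<longrightarrow>
        (\<forall>u\<in>U. curvature \<Gamma> X Y Z u = c *\<^sub>R (metric_form T Y Z u *\<^sub>R X u - metric_form T X Z u *\<^sub>R Y u)))"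

text \<open>The trace at \<open>u\<close> of $X \mapsto R(X,Y)Z$. As the curvature is tensorial, a tangent vector \<open>v\<close>
  at \<open>u\<close> may be extended to the vector field with constant components.\<close>

definition ricci ::
    "(real^'m \<Rightarrow> 'm \<Rightarrow> 'm \<Rightarrow> 'm \<Rightarrow> real) \<Rightarrow>
      'm::finite vfield \<Rightarrow> 'm vfield \<Rightarrow> real^'m \<Rightarrow> real" where
  "ricci \<Gamma> Y Z u = trace (matrix (\<lambda>v. curvature \<Gamma> (\<lambda>_. v) Y Z u))"

end

theory Submission
  imports Defs
begin

text \<open>Put \<open>f = exp \<phi>\<close>. Up to a term which depends on \<open>q\<close> only, the L-divergence $T(q \mid p)$ is
  \<open>ln (f p + df p (q - p))\<close>, and the argument of this logarithm is an affine function of \<open>q\<close>. An affine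
  function on the simplex is the restriction of a linear one, so that with the lift \<open>A\<close> of a point \<open>q\<close> to
  \<open>q / f q\<close> and the covector \<open>B\<close> representing the first-order Taylor polynomial of \<open>f\<close> at \<open>p\<close> the
  divergence becomes, in coordinates, \<open>T u u' = ln (A u \<bullet> B u')\<close> exactly. Concavity of \<open>f\<close> says that \<open>A u \<bullet> B u' \<ge> 1\<close>, with equality on the
  diagonal; hence all first derivatives of the pairing vanish on the diagonal, and \<open>B\<close> is the conormal
  of the centroaffine hypersurface \<open>A\<close>.

  Writing indices for partial derivatives, the mixed derivatives of \<open>T\<close> on the diagonal reduce to
  $g_{ij} = -A_i \cdot B_j$, $\Gamma_{ijk} = -A_{ij} \cdot B_k$ and
  $\Gamma^*_{ijk} = -B_{ij} \cdot A_k$. Since \<open>B\<close> and its derivatives span the ambient space, the first two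
  of these amount to the Gauss formula $A_{ij} = \sum_k \Gamma_{ij}^k A_k + g_{ij} A$ (lemma
  \<open>gauss_formula\<close>). The ambient space is flat, so commuting two derivatives of a tangential field and
  comparing tangential parts gives \<open>R(X,Y)Z = -(g(Y,Z) X - g(X,Z) Y)\<close>: the position vector in the normal
  part of the Gauss formula, when differentiated, returns a tangent vector (\<open>curvature_eq\<close>). The
  situation is symmetric in \<open>A\<close> and \<open>B\<close>, which yields the dual connection at the same time. The
  metric is nondegenerate because \<open>g\<close> is the negative of the Hessian of \<open>f\<close>, pulled back to the
  coordinate domain and divided by \<open>f\<close> (\<open>lift_conormal_geometry\<close>).

  Taking the trace over \<open>X\<close> in dimension \<open>n - 1\<close> gives \<open>-(n - 1) g + g\<close>, whence the Einstein condition.\<close>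

section \<open>Differential calculus of smooth maps\<close>

abbreviation \<D> :: "('a::real_normed_vector \<Rightarrow> 'b::real_normed_vector) \<Rightarrow> 'a \<Rightarrow> 'a \<Rightarrow> 'b"
  where "\<D> f u \<equiv> frechet_derivative f (at u)"

text \<open>On open sets the \<open>Cinf_on\<close> maps are exactly the \<open>smooth_on\<close> ones (\<open>Cinf_on_iff_smooth_on\<close>), but without a
  local extension in the way: this is the form on which differential calculus can be carried out.\<close>

definition Cinf_on :: "('a::real_normed_vector \<Rightarrow> 'b::real_normed_vector) \<Rightarrow> 'a set \<Rightarrow> bool"
  where "Cinf_on f U \<longleftrightarrow> (\<forall>k. Ck_on k f U)"

lemma has_derivative_D: "f differentiable at u \<Longrightarrow> (f has_derivative \<D> f u) (at u)"
  by (simp add: frechet_derivative_works)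

lemma D_eq: "(f has_derivative f') (at u) \<Longrightarrow> \<D> f u = f'"
  by (metis frechet_derivative_at)

lemma D_cong:
  assumes "open U" "u \<in> U" "\<And>a. a \<in> U \<Longrightarrow> f a = g a"
  shows "\<D> f u = \<D> g u"
proof -
  have "(f has_derivative f') (at u) \<longleftrightarrow> (g has_derivative f') (at u)" for f'
    using assms by (metis has_derivative_transform_within_open)
  then show ?thesis by (simp add: frechet_derivative_def)
qed

lemma dirderiv_eq_D:
  assumes "f differentiable at u"
  shows "dirderiv f u v = \<D> f u v"
proof -
  have 1: "((\<lambda>t. u + t *\<^sub>R v) has_derivative (\<lambda>t. t *\<^sub>R v)) (at 0)"
    by (auto intro!: derivative_eq_intros)
  have 2: "(f has_derivative \<D> f u) (at (u + 0 *\<^sub>R v))"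
    using has_derivative_D[OF assms] by simp
  have "((\<lambda>t. f (u + t *\<^sub>R v)) has_derivative (\<lambda>t. \<D> f u (t *\<^sub>R v))) (at 0)"
    using has_derivative_compose[OF 1 2] .
  moreover have "\<D> f u (t *\<^sub>R v) = \<D> f u v * t" for t
    using linear_scale[OF linear_frechet_derivative[OF assms]] by simp
  ultimately have "((\<lambda>t. f (u + t *\<^sub>R v)) has_field_derivative \<D> f u v) (at 0)"
    by (simp add: has_field_derivative_def)
  then show ?thesis by (simp add: dirderiv_def DERIV_imp_deriv)
qed

lemma dirderiv_eq: "(f has_derivative f') (at u) \<Longrightarrow> dirderiv f u v = f' v"
  by (metis D_eq differentiableI dirderiv_eq_D)

lemma dirderiv_cong:
  assumes "open U" "u \<in> U" "\<And>a. a \<in> U \<Longrightarrow> f a = g a"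
  shows "dirderiv f u v = dirderiv g u v"
proof -
  have "open ((\<lambda>t. u + t *\<^sub>R v) -` U)"
    by (intro open_vimage assms continuous_intros)
  then have "eventually (\<lambda>t. u + t *\<^sub>R v \<in> U) (nhds (0::real))"
    using assms(2) by (auto simp: eventually_nhds)
  then have "eventually (\<lambda>t. f (u + t *\<^sub>R v) = g (u + t *\<^sub>R v)) (nhds (0::real))"
    by eventually_elim (use assms in auto)
  then show ?thesis by (simp add: dirderiv_def deriv_cong_ev)
qed

lemma Ck_on_cong:
  assumes "open U"
  shows "(\<And>a. a \<in> U \<Longrightarrow> f a = g a) \<Longrightarrow> Ck_on k f U \<Longrightarrow> Ck_on k g U"
proof (induction k arbitrary: f g)
  case 0
  then show ?case using continuous_on_cong by force
next
  case (Suc k)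
  have "g differentiable_on U"
    unfolding differentiable_on_eq_differentiable_at[OF assms]
  proof
    fix a assume "a \<in> U"
    then have "(f has_derivative \<D> f a) (at a)"
      using Suc.prems assms by (auto simp: differentiable_on_eq_differentiable_at has_derivative_D)
    then have "(g has_derivative \<D> f a) (at a)"
      by (rule has_derivative_transform_within_open[OF _ assms \<open>a \<in> U\<close>]) (rule Suc.prems(1))
    then show "g differentiable at a" by (rule differentiableI)
  qed
  moreover have "Ck_on k (\<lambda>x. \<D> g x v) U" for v
    by (rule Suc.IH[of "\<lambda>x. \<D> f x v"])
       (use Suc.prems D_cong[OF assms, of _ f g] in auto)
  ultimately show ?case by simp
qed

lemma Ck_on_subset: "Ck_on k f U \<Longrightarrow> W \<subseteq> U \<Longrightarrow> Ck_on k f W"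
  by (induction k arbitrary: f) (auto intro: continuous_on_subset differentiable_on_subset)

lemma Ck_on_pred: "Ck_on (Suc k) f U \<Longrightarrow> Ck_on k f U"
  by (induction k arbitrary: f) (auto intro: differentiable_imp_continuous_on)

lemma Ck_on_local:
  assumes "open U" "\<And>u. u \<in> U \<Longrightarrow> \<exists>W. open W \<and> u \<in> W \<and> Ck_on k f W"
  shows "Ck_on k f U"
  using assms(2)
proof (induction k arbitrary: f)
  case 0
  then show ?case
    by (simp add: continuous_on_eq_continuous_at assms(1)) (metis continuous_on_eq_continuous_at)
next
  case (Suc k)
  then show ?case
    by (simp add: differentiable_on_eq_differentiable_at assms(1))
       (metis differentiable_on_eq_differentiable_at)
qed

lemma Ck_on_const [simp]: "Ck_on k (\<lambda>_. c) U"
  by (induction k arbitrary: c) auto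

lemma Ck_on_add:
  assumes "open U"
  shows "Ck_on k f U \<Longrightarrow> Ck_on k g U \<Longrightarrow> Ck_on k (\<lambda>a. f a + g a) U"
proof (induction k arbitrary: f g)
  case 0
  then show ?case by (simp add: continuous_on_add)
next
  case (Suc k)
  have d: "f differentiable at a" "g differentiable at a" if "a \<in> U" for a
    using Suc.prems that assms by (auto simp: differentiable_on_eq_differentiable_at)
  have hd: "((\<lambda>a. f a + g a) has_derivative (\<lambda>v. \<D> f a v + \<D> g a v)) (at a)" if "a \<in> U" for a
    by (intro has_derivative_add has_derivative_D d that)
  have "Ck_on k (\<lambda>a. \<D> f a v + \<D> g a v) U" for v
    using Suc by auto
  then have "Ck_on k (\<lambda>a. \<D> (\<lambda>a. f a + g a) a v) U" for v
    by (rule Ck_on_cong[OF assms, rotated]) (simp add: D_eq[OF hd])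
  then show ?case using Suc.prems by (auto intro: differentiable_on_add)
qed

lemma Ck_on_sum:
  assumes "open U" "\<And>i. i \<in> I \<Longrightarrow> Ck_on k (f i) U"
  shows "Ck_on k (\<lambda>a. \<Sum>i\<in>I. f i a) U"
  using assms(2) by (induction I rule: infinite_finite_induct) (auto intro: Ck_on_add assms(1))

lemma Ck_on_bilinear:
  assumes bop: "bounded_bilinear bop" and "open U"
  shows "Ck_on k f U \<Longrightarrow> Ck_on k g U \<Longrightarrow> Ck_on k (\<lambda>a. bop (f a) (g a)) U"
proof (induction k arbitrary: f g)
  case 0
  then show ?case using bounded_bilinear.continuous_on[OF bop] by simp
next
  case (Suc k)
  have d: "f differentiable at a" "g differentiable at a" if "a \<in> U" for a
    using Suc.prems that assms(2) by (auto simp: differentiable_on_eq_differentiable_at)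
  have hd: "((\<lambda>a. bop (f a) (g a)) has_derivative (\<lambda>v. bop (f a) (\<D> g a v) + bop (\<D> f a v) (g a))) (at a)"
    if "a \<in> U" for a
    by (intro bounded_bilinear.FDERIV[OF bop] has_derivative_D d that)
  have "Ck_on k (\<lambda>a. bop (f a) (\<D> g a v) + bop (\<D> f a v) (g a)) U" for v
    using Suc.prems by (intro Ck_on_add assms(2) Suc.IH) (auto intro: Ck_on_pred)
  then have "Ck_on k (\<lambda>a. \<D> (\<lambda>a. bop (f a) (g a)) a v) U" for v
    by (rule Ck_on_cong[OF assms(2), rotated]) (simp add: D_eq[OF hd])
  then show ?case
    using hd by (auto simp: differentiable_on_eq_differentiable_at assms intro: differentiableI)
qed

lemma Ck_on_exp:
  fixes f :: "'a::real_normed_vector \<Rightarrow> real"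
  assumes "open U"
  shows "Ck_on k f U \<Longrightarrow> Ck_on k (\<lambda>a. exp (f a)) U"
proof (induction k)
  case 0
  then show ?case by (simp add: continuous_on_exp)
next
  case (Suc k)
  have hd: "((\<lambda>a. exp (f a)) has_derivative (\<lambda>v. exp (f a) * \<D> f a v)) (at a)" if "a \<in> U" for a
    using Suc.prems that assms
    by (auto simp: differentiable_on_eq_differentiable_at intro!: derivative_eq_intros has_derivative_D)
  have "Ck_on k (\<lambda>a. exp (f a) * \<D> f a v) U" for v
    using Suc by (intro Ck_on_bilinear[OF bounded_bilinear_mult] assms Suc.IH)
      (auto intro: Ck_on_pred)
  then have "Ck_on k (\<lambda>a. \<D> (\<lambda>a. exp (f a)) a v) U" for v
    by (rule Ck_on_cong[OF assms, rotated]) (simp add: D_eq[OF hd])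
  then show ?case
    using hd by (auto simp: differentiable_on_eq_differentiable_at assms intro: differentiableI)
qed

lemma D_linear_expand:
  fixes f :: "'a::euclidean_space \<Rightarrow> 'b::real_normed_vector"
  assumes "f differentiable at u"
  shows "\<D> f u w = (\<Sum>b\<in>Basis. (w \<bullet> b) *\<^sub>R \<D> f u b)"
proof -
  interpret linear "\<D> f u" by (rule linear_frechet_derivative[OF assms])
  have "\<D> f u w = \<D> f u (\<Sum>b\<in>Basis. (w \<bullet> b) *\<^sub>R b)" by (simp add: euclidean_representation)
  then show ?thesis by (simp add: sum scale)
qed

text \<open>Induction on the order: by the chain rule, each directional derivative of \<open>F \<circ> f\<close> is a finite sum of
  products of a component of a derivative of \<open>f\<close> with a partial derivative of \<open>F\<close> composed with \<open>f\<close>.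
  Expanding in the basis keeps the direction of every derivative of \<open>F\<close> constant, so that the
  induction hypothesis applies to it.\<close>

lemma Ck_on_compose:
  fixes F :: "'b::euclidean_space \<Rightarrow> 'c::real_normed_vector"
  assumes "open U" "open W" "f ` U \<subseteq> W"
  shows "Ck_on k F W \<Longrightarrow> Ck_on k f U \<Longrightarrow> Ck_on k (\<lambda>a. F (f a)) U"
proof (induction k arbitrary: F)
  case 0
  then show ?case using assms by (auto intro: continuous_on_compose2)
next
  case (Suc k)
  have d: "f differentiable at a" "F differentiable at (f a)" if "a \<in> U" for a
    using Suc.prems that assms by (auto simp: differentiable_on_eq_differentiable_at)
  have hd: "((\<lambda>a. F (f a)) has_derivative (\<lambda>v. \<D> F (f a) (\<D> f a v))) (at a)" if "a \<in> U" for a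
    using has_derivative_compose[OF has_derivative_D has_derivative_D] d that by blast
  have eq: "\<D> (\<lambda>a. F (f a)) a v = (\<Sum>b\<in>Basis. (\<D> f a v \<bullet> b) *\<^sub>R \<D> F (f a) b)" if "a \<in> U" for a v
    unfolding D_eq[OF hd[OF that]] by (rule D_linear_expand[OF d(2)[OF that]])
  have "Ck_on k (\<lambda>a. \<Sum>b\<in>Basis. (\<D> f a v \<bullet> b) *\<^sub>R \<D> F (f a) b) U" for v
    using Suc.prems
    by (intro Ck_on_sum Ck_on_bilinear[OF bounded_bilinear_scaleR]
        Ck_on_bilinear[OF bounded_bilinear_inner] Suc.IH assms) (auto intro: Ck_on_pred)
  then have "Ck_on k (\<lambda>a. \<D> (\<lambda>a. F (f a)) a v) U" for v
    by (rule Ck_on_cong[OF assms(1), rotated]) (simp add: eq)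
  then show ?case
    using hd by (auto simp: differentiable_on_eq_differentiable_at assms intro: differentiableI)
qed

lemma Cinf_on_differentiable:
  assumes "Cinf_on f U" "open U" "u \<in> U"
  shows "f differentiable at u"
proof -
  have "Ck_on (Suc 0) f U" using assms(1) by (simp only: Cinf_on_def)
  then show ?thesis using assms by (simp add: differentiable_on_eq_differentiable_at)
qed

lemma Cinf_on_D:
  assumes "Cinf_on f U"
  shows "Cinf_on (\<lambda>a. \<D> f a v) U"
  unfolding Cinf_on_def
proof
  fix k
  have "Ck_on (Suc k) f U" using assms by (simp only: Cinf_on_def)
  then show "Ck_on k (\<lambda>a. \<D> f a v) U" by simp
qed

lemma Cinf_on_cong:
  assumes "open U" "\<And>a. a \<in> U \<Longrightarrow> f a = g a" "Cinf_on f U"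
  shows "Cinf_on g U"
  unfolding Cinf_on_def
proof
  fix k
  have "Ck_on k f U" using assms(3) by (simp only: Cinf_on_def)
  with assms(1,2) show "Ck_on k g U" by (rule Ck_on_cong)
qed

lemma Cinf_on_continuous:
  assumes "Cinf_on f U"
  shows "continuous_on U f"
proof -
  have "Ck_on 0 f U" using assms by (simp only: Cinf_on_def)
  then show ?thesis by simp
qed

text \<open>A derivative in a variable direction is a combination, with smooth coefficients, of derivatives in
  the finitely many basis directions.\<close>

lemma Cinf_on_D_field:
  fixes f :: "'a::euclidean_space \<Rightarrow> 'b::real_normed_vector"
  assumes "open U" "Cinf_on f U" "Cinf_on X U"
  shows "Cinf_on (\<lambda>a. \<D> f a (X a)) U"
proof -
  have "Cinf_on (\<lambda>a. \<Sum>b\<in>Basis. (X a \<bullet> b) *\<^sub>R \<D> f a b) U"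
    using assms Cinf_on_D[OF assms(2)] unfolding Cinf_on_def
    by (intro allI Ck_on_sum Ck_on_bilinear[OF bounded_bilinear_scaleR]
        Ck_on_bilinear[OF bounded_bilinear_inner] assms) auto
  moreover have "\<D> f a (X a) = (\<Sum>b\<in>Basis. (X a \<bullet> b) *\<^sub>R \<D> f a b)" if "a \<in> U" for a
    using D_linear_expand Cinf_on_differentiable assms that by blast
  ultimately show ?thesis
    by - (rule Cinf_on_cong[OF assms(1)], simp_all)
qed

lemma Cinf_on_iff_smooth_on: "open U \<Longrightarrow> smooth_on U f \<longleftrightarrow> Cinf_on f U"
proof
  assume "open U" and f: "smooth_on U f"
  show "Cinf_on f U" unfolding Cinf_on_def
  proof (intro allI Ck_on_local \<open>open U\<close>)
    fix k u assume "u \<in> U"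
    then obtain W F where W: "open W" "u \<in> W" "\<forall>k. Ck_on k F W" "\<forall>q\<in>W \<inter> U. F q = f q"
      using f unfolding smooth_on_def by blast
    have "Ck_on k f (W \<inter> U)"
      by (rule Ck_on_cong[of _ F]) (use W \<open>open U\<close> Ck_on_subset[of _ F W "W \<inter> U"] in auto)
    then show "\<exists>W. open W \<and> u \<in> W \<and> Ck_on k f W"
      using W \<open>open U\<close> \<open>u \<in> U\<close> by (intro exI[of _ "W \<inter> U"]) auto
  qed
next
  assume "open U" "Cinf_on f U"
  then show "smooth_on U f" unfolding smooth_on_def Cinf_on_def by blast
qed

lemma Cinf_on_const: "Cinf_on (\<lambda>_. c) U"
  by (simp add: Cinf_on_def)

lemma Cinf_on_ident:
  assumes "open U" shows "Cinf_on (\<lambda>a. a) U"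
  unfolding Cinf_on_def
proof
  show "Ck_on k (\<lambda>a. a) U" for k by (cases k) auto
qed

lemma Cinf_on_bilinear:
  "bounded_bilinear bop \<Longrightarrow> open U \<Longrightarrow> Cinf_on f U \<Longrightarrow> Cinf_on g U \<Longrightarrow> Cinf_on (\<lambda>a. bop (f a) (g a)) U"
  by (simp add: Cinf_on_def Ck_on_bilinear)

lemmas Cinf_on_scaleR = Cinf_on_bilinear[OF bounded_bilinear_scaleR]
  and Cinf_on_mult = Cinf_on_bilinear[OF bounded_bilinear_mult]

lemma Cinf_on_add: "open U \<Longrightarrow> Cinf_on f U \<Longrightarrow> Cinf_on g U \<Longrightarrow> Cinf_on (\<lambda>a. f a + g a) U"
  by (simp add: Cinf_on_def Ck_on_add)

lemma Cinf_on_uminus: "open U \<Longrightarrow> Cinf_on f U \<Longrightarrow> Cinf_on (\<lambda>a. - f a) U"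
  using Cinf_on_scaleR[OF _ Cinf_on_const[of "-1" U], of f] by simp

lemma Cinf_on_diff: "open U \<Longrightarrow> Cinf_on f U \<Longrightarrow> Cinf_on g U \<Longrightarrow> Cinf_on (\<lambda>a. f a - g a) U"
  using Cinf_on_add[OF _ _ Cinf_on_uminus, of U f g] by simp

lemma Cinf_on_exp: "open U \<Longrightarrow> Cinf_on f U \<Longrightarrow> Cinf_on (\<lambda>a. exp (f a :: real)) U"
  by (simp add: Cinf_on_def Ck_on_exp)

lemma Cinf_on_vec:
  fixes f :: "'a::real_normed_vector \<Rightarrow> 'n::finite \<Rightarrow> real"
  assumes "open U" "\<And>i. Cinf_on (\<lambda>a. f a i) U"
  shows "Cinf_on (\<lambda>a. \<chi> i. f a i) U"
proof -
  have "Cinf_on (\<lambda>a. \<Sum>i\<in>UNIV. f a i *\<^sub>R axis i (1::real)) U"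
    unfolding Cinf_on_def
    by (intro allI Ck_on_sum Ck_on_bilinear[OF bounded_bilinear_scaleR] assms(1) Ck_on_const
        assms(2)[unfolded Cinf_on_def, rule_format])
  moreover have "(\<Sum>i\<in>UNIV. f a i *\<^sub>R axis i 1) = (\<chi> i. f a i)" for a
    using basis_expansion[of "\<chi> i. f a i"] by (simp add: scalar_mult_eq_scaleR)
  ultimately show ?thesis by simp
qed

lemma smooth_on_ext:
  assumes "smooth_on S f" "p \<in> S"
  shows "\<exists>W F. open W \<and> p \<in> W \<and> Cinf_on F W \<and> (\<forall>q\<in>W \<inter> S. F q = f q)"
  using bspec[OF assms(1)[unfolded smooth_on_def] assms(2)] unfolding Cinf_on_def .

text \<open>For a coordinate map \<open>x\<close> into the simplex, this turns smoothness relative to the simplex, which only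
  speaks of local ambient extensions, into ordinary smoothness on the coordinate domain.\<close>

lemma smooth_on_compose:
  fixes f :: "'b::euclidean_space \<Rightarrow> 'c::real_normed_vector"
  assumes U: "open U" and f: "smooth_on S f" and x: "Cinf_on x U" and xS: "x ` U \<subseteq> S"
  shows "Cinf_on (\<lambda>u. f (x u)) U"
  unfolding Cinf_on_def
proof (intro allI Ck_on_local U)
  fix k u assume u: "u \<in> U"
  obtain W F where W: "open W" "x u \<in> W" "Cinf_on F W" "\<forall>q\<in>W \<inter> S. F q = f q"
    using smooth_on_ext[OF f, of "x u"] u xS by auto
  let ?N = "U \<inter> x -` W"
  have N: "open ?N"
    using continuous_open_preimage[OF Cinf_on_continuous[OF x] U W(1)] .
  have "Ck_on k (\<lambda>u. F (x u)) ?N"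
  proof (rule Ck_on_compose[OF N W(1)])
    show "Ck_on k F W" using W(3) by (simp add: Cinf_on_def)
    show "Ck_on k x ?N" using x Ck_on_subset[of k x U ?N] by (simp add: Cinf_on_def)
  qed auto
  then have "Ck_on k (\<lambda>u. f (x u)) ?N"
    by (rule Ck_on_cong[OF N, rotated]) (use W(4) xS in auto)
  then show "\<exists>N. open N \<and> u \<in> N \<and> Ck_on k (\<lambda>u. f (x u)) N"
    using N u W(2) by (intro exI[of _ ?N]) simp
qed

lemma D_linear:
  assumes "f differentiable at u"
  shows "\<D> f u (a + b) = \<D> f u a + \<D> f u b"
    and "\<D> f u (a - b) = \<D> f u a - \<D> f u b"
    and "\<D> f u (c *\<^sub>R a) = c *\<^sub>R \<D> f u a"
    and "\<D> f u (\<Sum>i\<in>I. h i) = (\<Sum>i\<in>I. \<D> f u (h i))"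
    and "\<D> f u 0 = 0"
  using linear_frechet_derivative[OF assms]
  by (simp_all add: linear_add linear_diff linear_scale linear_sum linear_0)

lemma D_axis_expand:
  fixes f :: "real^'m \<Rightarrow> 'b::real_normed_vector"
  assumes "f differentiable at u"
  shows "\<D> f u w = (\<Sum>i\<in>UNIV. (w $ i) *\<^sub>R \<D> f u (axis i 1))"
proof -
  have "\<D> f u w = \<D> f u (\<Sum>i\<in>UNIV. (w $ i) *\<^sub>R axis i 1)"
    using basis_expansion[of w] by (simp add: scalar_mult_eq_scaleR)
  then show ?thesis by (simp add: D_linear[OF assms])
qed

lemma D_nth:
  fixes f :: "'a::real_normed_vector \<Rightarrow> real^'m"
  assumes "f differentiable at u"
  shows "((\<lambda>a. f a $ k) has_derivative (\<lambda>v. \<D> f u v $ k)) (at u)"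
  using bounded_linear.has_derivative[OF bounded_linear_vec_nth has_derivative_D[OF assms]] .

lemma differentiable_cart_component:
  fixes f :: "'a::real_normed_vector \<Rightarrow> real^'m"
  assumes "\<And>k. (\<lambda>a. f a $ k) differentiable at u"
  shows "f differentiable at u"
proof -
  have "(\<lambda>a. \<Sum>k\<in>UNIV. (f a $ k) *\<^sub>R (axis k 1 :: real^'m)) differentiable at u"
    by (auto intro!: differentiable_sum differentiable_scaleR assms)
  then show ?thesis
    by (simp only: scalar_mult_eq_scaleR[symmetric] basis_expansion)
qed


section \<open>Symmetry of second derivatives and the Lie bracket\<close>

text \<open>The product rule for the evaluation of a derivative along a vector field.\<close>

lemma D_along_field:
  fixes f :: "'a::euclidean_space \<Rightarrow> 'b::real_normed_vector"
  assumes "open U" "u \<in> U" "Cinf_on f U" "Y differentiable at u"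
  shows "((\<lambda>a. \<D> f a (Y a)) has_derivative
           (\<lambda>w. \<D> (\<lambda>a. \<D> f a (Y u)) u w + \<D> f u (\<D> Y u w))) (at u)"
proof -
  have df: "f differentiable at a" if "a \<in> U" for a
    using Cinf_on_differentiable assms that by blast
  have ddf: "(\<lambda>a. \<D> f a v) differentiable at u" for v
    using Cinf_on_differentiable Cinf_on_D assms by blast
  have 1: "((\<lambda>a. \<Sum>b\<in>Basis. (c a \<bullet> b) *\<^sub>R \<D> f a b) has_derivative
      (\<lambda>w. (\<Sum>b\<in>Basis. (c u \<bullet> b) *\<^sub>R \<D> (\<lambda>a. \<D> f a b) u w + (\<D> c u w \<bullet> b) *\<^sub>R \<D> f u b))) (at u)"
    if "c differentiable at u" for c
    by (intro derivative_intros has_derivative_D ddf bounded_linear.has_derivative[OF bounded_linear_inner_left] that)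
  have 2: "((\<lambda>a. \<D> f a (c a)) has_derivative
      (\<lambda>w. (\<Sum>b\<in>Basis. (c u \<bullet> b) *\<^sub>R \<D> (\<lambda>a. \<D> f a b) u w + (\<D> c u w \<bullet> b) *\<^sub>R \<D> f u b))) (at u)"
    if "c differentiable at u" for c
    by (rule has_derivative_transform_within_open[OF 1[OF that] assms(1,2)])
       (rule D_linear_expand[OF df, symmetric])
  have "\<D> (\<lambda>a. \<D> f a (Y u)) u w = (\<Sum>b\<in>Basis. (Y u \<bullet> b) *\<^sub>R \<D> (\<lambda>a. \<D> f a b) u w)" for w
    by (subst D_eq[OF 2]) auto
  then show ?thesis
    using 2[OF assms(4)] D_linear_expand[OF df[OF assms(2)], of "\<D> Y u w" for w]
    by (simp add: sum.distrib)
qed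

text \<open>Both mixed derivatives are limits of the same second difference quotient over the
  parallelogram spanned by \<open>s v\<close> and \<open>s w\<close>; the mean value theorem, applied once in each direction,
  evaluates that quotient.\<close>

lemma second_difference_mvt:
  fixes f :: "'a::real_normed_vector \<Rightarrow> real"
  assumes "open U" "Cinf_on f U" "0 < s"
    and par: "\<And>a b. 0 \<le> a \<Longrightarrow> a \<le> s \<Longrightarrow> 0 \<le> b \<Longrightarrow> b \<le> s \<Longrightarrow> u + a *\<^sub>R v + b *\<^sub>R w \<in> U"
  shows "\<exists>a b. 0 < a \<and> a < s \<and> 0 < b \<and> b < s \<and>
     f (u + s *\<^sub>R v + s *\<^sub>R w) - f (u + s *\<^sub>R v) - f (u + s *\<^sub>R w) + f u
      = s * s * \<D> (\<lambda>p. \<D> f p v) (u + a *\<^sub>R v + b *\<^sub>R w) w"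
proof -
  have line: "((\<lambda>t. g (p + t *\<^sub>R z)) has_real_derivative \<D> g (p + t *\<^sub>R z) z) (at t)"
    if "p + t *\<^sub>R z \<in> U" "Cinf_on g U" for g :: "'a \<Rightarrow> real" and p z t
  proof -
    have d: "g differentiable at (p + t *\<^sub>R z)"
      using Cinf_on_differentiable assms that by blast
    have 1: "((\<lambda>t. p + t *\<^sub>R z) has_derivative (\<lambda>t. t *\<^sub>R z)) (at t)"
      by (auto intro!: derivative_eq_intros)
    have "\<D> g (p + t *\<^sub>R z) (r *\<^sub>R z) = \<D> g (p + t *\<^sub>R z) z * r" for r
      using linear_scale[OF linear_frechet_derivative[OF d]] by simp
    with has_derivative_compose[OF 1 has_derivative_D[OF d]]
    show ?thesis by (simp add: has_field_derivative_def)
  qed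
  let ?g = "\<lambda>t. f (u + s *\<^sub>R w + t *\<^sub>R v) - f (u + t *\<^sub>R v)"
  have in1: "u + s *\<^sub>R w + t *\<^sub>R v \<in> U" if "0 \<le> t" "t \<le> s" for t
    using par[of t s] that assms(3) by (simp add: algebra_simps)
  have in2: "u + t *\<^sub>R v \<in> U" if "0 \<le> t" "t \<le> s" for t
    using par[of t 0] that assms(3) by (simp add: algebra_simps)
  have g: "(?g has_real_derivative (\<D> f (u + s *\<^sub>R w + t *\<^sub>R v) v - \<D> f (u + t *\<^sub>R v) v)) (at t)"
    if "0 \<le> t" "t \<le> s" for t
    by (intro DERIV_diff line in1 in2 that assms)
  obtain a where a: "0 < a" "a < s"
    "?g s - ?g 0 = s * (\<D> f (u + s *\<^sub>R w + a *\<^sub>R v) v - \<D> f (u + a *\<^sub>R v) v)"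
    using MVT2[OF assms(3) g] by auto
  let ?h = "\<lambda>t. \<D> f (u + a *\<^sub>R v + t *\<^sub>R w) v"
  have h: "(?h has_real_derivative \<D> (\<lambda>p. \<D> f p v) (u + a *\<^sub>R v + t *\<^sub>R w) w) (at t)"
    if "0 \<le> t" "t \<le> s" for t
    by (rule line[of _ _ _ "\<lambda>p. \<D> f p v"]) (use par a that in \<open>auto intro: Cinf_on_D assms\<close>)
  obtain b where b: "0 < b" "b < s" "?h s - ?h 0 = s * \<D> (\<lambda>p. \<D> f p v) (u + a *\<^sub>R v + b *\<^sub>R w) w"
    using MVT2[OF assms(3) h] by auto
  show ?thesis
    using a b by (intro exI[of _ a] exI[of _ b]) (simp add: algebra_simps)
qed

lemma second_derivative_symmetric_real:
  fixes f :: "'a::real_normed_vector \<Rightarrow> real"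
  assumes U: "open U" "u \<in> U" and f: "Cinf_on f U"
  shows "\<D> (\<lambda>p. \<D> f p v) u w = \<D> (\<lambda>p. \<D> f p w) u v"
proof (rule ccontr)
  let ?F = "\<lambda>v w p. \<D> (\<lambda>p. \<D> f p v) p w"
  assume ne: "?F v w u \<noteq> ?F w v u"
  define e where "e = \<bar>?F v w u - ?F w v u\<bar> / 2"
  have "0 < e" using ne by (simp add: e_def)
  have near: "\<exists>d>0. \<forall>p. dist p u < d \<longrightarrow> p \<in> U \<and> \<bar>?F y z p - ?F y z u\<bar> < e" for y z
  proof -
    have "isCont (?F y z) u"
      using Cinf_on_continuous[OF Cinf_on_D[OF Cinf_on_D[OF f]]] U continuous_on_eq_continuous_at by blast
    then obtain d1 where "d1 > 0" "\<forall>p. dist p u < d1 \<longrightarrow> \<bar>?F y z p - ?F y z u\<bar> < e"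
      using \<open>0 < e\<close> unfolding continuous_at_eps_delta dist_real_def by blast
    moreover obtain d2 where "d2 > 0" "\<forall>p. dist p u < d2 \<longrightarrow> p \<in> U"
      using U by (metis open_dist)
    ultimately show ?thesis by (intro exI[of _ "min d1 d2"]) auto
  qed
  obtain d1 where d1: "d1 > 0" "\<And>p. dist p u < d1 \<Longrightarrow> p \<in> U \<and> \<bar>?F v w p - ?F v w u\<bar> < e"
    using near by blast
  obtain d2 where d2: "d2 > 0" "\<And>p. dist p u < d2 \<Longrightarrow> p \<in> U \<and> \<bar>?F w v p - ?F w v u\<bar> < e"
    using near by blast
  \<comment> \<open>The side of a parallelogram whose points all lie in both neighbourhoods of \<open>u\<close>.\<close>
  define s where "s = min d1 d2 / (norm v + norm w + 1)"
  have pos: "norm v + norm w + 1 > 0" by (simp add: add_nonneg_pos)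
  have "s > 0" using d1 d2 pos by (simp add: s_def)
  have small: "dist (u + a *\<^sub>R v + b *\<^sub>R w) u < min d1 d2" if "0 \<le> a" "a \<le> s" "0 \<le> b" "b \<le> s" for a b
  proof -
    have "dist (u + a *\<^sub>R v + b *\<^sub>R w) u \<le> a * norm v + b * norm w"
      using that by (simp add: dist_norm) (metis abs_of_nonneg norm_scaleR norm_triangle_ineq)
    also have "\<dots> \<le> s * norm v + s * norm w"
      using that by (intro add_mono mult_right_mono) auto
    also have "\<dots> < s * (norm v + norm w + 1)" using \<open>s > 0\<close> by (simp add: algebra_simps)
    also have "\<dots> = min d1 d2" using pos by (simp add: s_def)
    finally show ?thesis .
  qed
  obtain a b where ab: "0 < a" "a < s" "0 < b" "b < s"
    "f (u + s *\<^sub>R v + s *\<^sub>R w) - f (u + s *\<^sub>R v) - f (u + s *\<^sub>R w) + f u = s * s * ?F v w (u + a *\<^sub>R v + b *\<^sub>R w)"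
    using second_difference_mvt[OF U(1) f \<open>s > 0\<close>, of u v w] small d1 by fastforce
  have small': "dist (u + a *\<^sub>R w + b *\<^sub>R v) u < min d1 d2" if "0 \<le> a" "a \<le> s" "0 \<le> b" "b \<le> s" for a b
    using small[of b a] that by (simp add: algebra_simps)
  obtain a' b' where ab': "0 < a'" "a' < s" "0 < b'" "b' < s"
    "f (u + s *\<^sub>R w + s *\<^sub>R v) - f (u + s *\<^sub>R w) - f (u + s *\<^sub>R v) + f u = s * s * ?F w v (u + a' *\<^sub>R w + b' *\<^sub>R v)"
    using second_difference_mvt[OF U(1) f \<open>s > 0\<close>, of u w v] small' d1 by fastforce
  have "s * s * ?F v w (u + a *\<^sub>R v + b *\<^sub>R w) = s * s * ?F w v (u + a' *\<^sub>R w + b' *\<^sub>R v)"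
    using ab(5) ab'(5) by (simp add: algebra_simps)
  then have "?F v w (u + a *\<^sub>R v + b *\<^sub>R w) = ?F w v (u + a' *\<^sub>R w + b' *\<^sub>R v)"
    using \<open>s > 0\<close> by simp
  moreover have "\<bar>?F v w (u + a *\<^sub>R v + b *\<^sub>R w) - ?F v w u\<bar> < e"
    using d1 small[of a b] ab by auto
  moreover have "\<bar>?F w v (u + a' *\<^sub>R w + b' *\<^sub>R v) - ?F w v u\<bar> < e"
    using d2 small'[of a' b'] ab' by auto
  ultimately show False unfolding e_def by (simp add: abs_if split: if_splits)
qed

lemma D_inner:
  assumes "f differentiable at u"
  shows "\<D> (\<lambda>a. f a \<bullet> c) u v = \<D> f u v \<bullet> c"
  by (subst D_eq[OF bounded_linear.has_derivative[OF bounded_linear_inner_left has_derivative_D[OF assms]]]) simp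

lemma second_derivative_symmetric:
  fixes f :: "'a::real_normed_vector \<Rightarrow> 'b::euclidean_space"
  assumes U: "open U" "u \<in> U" and f: "Cinf_on f U"
  shows "\<D> (\<lambda>p. \<D> f p v) u w = \<D> (\<lambda>p. \<D> f p w) u v"
proof (rule euclidean_eqI)
  fix b :: 'b
  have fb: "Cinf_on (\<lambda>a. f a \<bullet> b) U"
    using f U unfolding Cinf_on_def
    by (auto intro: Ck_on_bilinear[OF bounded_bilinear_inner])
  have 1: "\<D> (\<lambda>a. f a \<bullet> b) p y = \<D> f p y \<bullet> b" if "p \<in> U" for p y
    using D_inner Cinf_on_differentiable f U that by blast
  have "\<D> (\<lambda>p. \<D> (\<lambda>a. f a \<bullet> b) p y) u z = \<D> (\<lambda>p. \<D> f p y) u z \<bullet> b" for y z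
    by (subst D_cong[OF U 1], assumption) (rule D_inner[OF Cinf_on_differentiable[OF Cinf_on_D[OF f] U]])
  then show "\<D> (\<lambda>p. \<D> f p v) u w \<bullet> b = \<D> (\<lambda>p. \<D> f p w) u v \<bullet> b"
    using second_derivative_symmetric_real[OF U fb, of v w] by simp
qed

lemma lie_bracket_eq:
  assumes "X differentiable at u" "Y differentiable at u"
  shows "lie_bracket X Y u = \<D> Y u (X u) - \<D> X u (Y u)"
proof -
  have "lie_bracket X Y u $ k = (\<D> Y u (X u) - \<D> X u (Y u)) $ k" for k
    using D_axis_expand[OF assms(1), of "Y u"] D_axis_expand[OF assms(2), of "X u"]
    by (simp add: lie_bracket_def dirderiv_eq[OF D_nth] assms sum_subtractf)
  then show ?thesis by (simp add: vec_eq_iff)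
qed

text \<open>Flatness of the ambient space: on vector-valued maps, derivatives along fields commute up to the Lie
  bracket. The second-order terms cancel by symmetry of second derivatives.\<close>

lemma mixed_derivative_commutator:
  fixes S :: "real^'m \<Rightarrow> 'v::euclidean_space"
  assumes U: "open U" "u \<in> U" and S: "Cinf_on S U"
    and X: "X differentiable at u" and Y: "Y differentiable at u"
  shows "\<D> (\<lambda>a. \<D> S a (Y a)) u (X u) - \<D> (\<lambda>a. \<D> S a (X a)) u (Y u) = \<D> S u (lie_bracket X Y u)"
  unfolding lie_bracket_eq[OF X Y] D_eq[OF D_along_field[OF U S X]] D_eq[OF D_along_field[OF U S Y]]
  using second_derivative_symmetric[OF U S, of "Y u" "X u"]
  by (simp add: D_linear[OF Cinf_on_differentiable[OF S U]])


section \<open>Linear systems with differentiable coefficients\<close>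

lemma det_differentiable:
  fixes M :: "'a::real_normed_vector \<Rightarrow> real^'m^'m"
  assumes "\<And>i j. (\<lambda>a. M a $ i $ j) differentiable at u"
  shows "(\<lambda>a. det (M a)) differentiable at u"
proof -
  have "(\<lambda>a. \<Prod>i\<in>UNIV. M a $ i $ p i) differentiable at u" for p
    by (rule differentiableI, rule has_derivative_prod, rule has_derivative_D[OF assms])
  then show ?thesis
    unfolding det_def by (auto intro!: differentiable_sum differentiable_mult simp: finite_permutations)
qed

text \<open>By Cramer's rule the solution is a quotient of determinants of differentiable entries. The covariant
  derivative of a smooth field is defined through an inverse matrix; its differentiability, needed to
  form the curvature, is obtained from here.\<close>

lemma linear_system_solution_differentiable:
  fixes M :: "'a::real_normed_vector \<Rightarrow> real^'m^'m"
  assumes U: "open U" "u \<in> U"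
    and sol: "\<And>a. a \<in> U \<Longrightarrow> M a *v W a = b a"
    and det: "\<And>a. a \<in> U \<Longrightarrow> det (M a) \<noteq> 0"
    and M: "\<And>i j. (\<lambda>a. M a $ i $ j) differentiable at u"
    and b: "\<And>i. (\<lambda>a. b a $ i) differentiable at u"
  shows "W differentiable at u"
proof (rule differentiable_cart_component)
  fix k
  let ?N = "\<lambda>a. \<chi> i j. if j = k then b a $ i else M a $ i $ j"
  have "(\<lambda>a. det (?N a) / det (M a)) differentiable at u"
  proof (intro differentiable_divide det_differentiable M det U)
    show "(\<lambda>a. ?N a $ i $ j) differentiable at u" for i j
      using M[of i j] b[of i] by (cases "j = k") simp_all
  qed
  then obtain D where D: "((\<lambda>a. det (?N a) / det (M a)) has_derivative D) (at u)"
    by (auto simp: differentiable_def)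
  have "((\<lambda>a. W a $ k) has_derivative D) (at u)"
  proof (rule has_derivative_transform_within_open[OF D U])
    fix a assume "a \<in> U"
    then show "det (?N a) / det (M a) = W a $ k"
      using cramer[OF det, of a "W a" "b a"] sol by (metis (no_types, lifting) vec_lambda_beta)
  qed
  then show "(\<lambda>a. W a $ k) differentiable at u" by (rule differentiableI)
qed


section \<open>Centroaffine immersions and the Gauss formula\<close>

lemma covariant_deriv_eq:
  assumes "Y differentiable at u"
  shows "covariant_deriv \<Gamma> X Y u =
    \<D> Y u (X u) + (\<Sum>i\<in>UNIV. \<Sum>j\<in>UNIV. (X u $ i * Y u $ j) *\<^sub>R (\<chi> k. \<Gamma> u i j k))"
proof -
  have "covariant_deriv \<Gamma> X Y u $ k =
    (\<D> Y u (X u) + (\<Sum>i\<in>UNIV. \<Sum>j\<in>UNIV. (X u $ i * Y u $ j) *\<^sub>R (\<chi> k. \<Gamma> u i j k))) $ k" for k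
    using D_axis_expand[OF assms, of "X u"]
    by (simp add: covariant_deriv_def dirderiv_eq[OF D_nth] assms sum.distrib distrib_left
        sum_distrib_left mult_ac)
  then show ?thesis by (simp add: vec_eq_iff)
qed

text \<open>In the nondegenerate case \<open>dual_immersions\<close> below, \<open>A\<close> parametrises a hypersurface transversal to its own
  position vector (a centroaffine immersion) and \<open>B\<close> is its conormal, normalised by \<open>A u \<bullet> B u = 1\<close>. The
  inequality says that the hypersurface lies on one side of each of its tangent hyperplanes. All
  hypotheses are symmetric in \<open>A\<close> and \<open>B\<close>, so that statements about the dual connection are instances of
  those about the primal one.\<close>

locale paired_maps =
  fixes A B :: "real^'m \<Rightarrow> 'v::euclidean_space" and U :: "(real^'m) set"
  assumes open_U: "open U"
    and smooth_A: "Cinf_on A U"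
    and smooth_B: "Cinf_on B U"
    and pair_ge: "\<And>a b. a \<in> U \<Longrightarrow> b \<in> U \<Longrightarrow> 1 \<le> A a \<bullet> B b"
    and pair_diag: "\<And>a. a \<in> U \<Longrightarrow> A a \<bullet> B a = 1"
begin

lemma swap: "paired_maps B A U"
  using open_U smooth_A smooth_B pair_ge pair_diag
  by unfold_locales (auto simp: inner_commute)

lemma deriv_A: "u \<in> U \<Longrightarrow> (A has_derivative \<D> A u) (at u)"
  and deriv_B: "u \<in> U \<Longrightarrow> (B has_derivative \<D> B u) (at u)"
  and deriv_DA: "u \<in> U \<Longrightarrow> ((\<lambda>a. \<D> A a w) has_derivative \<D> (\<lambda>a. \<D> A a w) u) (at u)"
  and deriv_DB: "u \<in> U \<Longrightarrow> ((\<lambda>a. \<D> B a w) has_derivative \<D> (\<lambda>a. \<D> B a w) u) (at u)"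
  by (auto intro!: has_derivative_D Cinf_on_differentiable[OF _ open_U] Cinf_on_D smooth_A smooth_B)

text \<open>The function \<open>\<lambda>a. A a \<bullet> B u\<close> has a minimum at \<open>a = u\<close>, so its derivative vanishes there: \<open>B u\<close> is
  conormal to \<open>A\<close> at \<open>u\<close>.\<close>

lemma DA_B:
  assumes "u \<in> U" shows "\<D> A u v \<bullet> B u = 0"
proof -
  have "((\<lambda>a. A a \<bullet> B u) has_derivative (\<lambda>v. \<D> A u v \<bullet> B u)) (at u)"
    by (intro bounded_linear.has_derivative[OF bounded_linear_inner_left] deriv_A assms)
  then have "(\<lambda>v. \<D> A u v \<bullet> B u) = (\<lambda>v. 0)"
    by (rule differential_zero_maxmin[OF assms open_U]) (simp add: pair_ge pair_diag assms)
  from fun_cong[OF this, of v] show ?thesis by simp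
qed

lemma A_DB: "u \<in> U \<Longrightarrow> A u \<bullet> \<D> B u v = 0"
  using paired_maps.DA_B[OF swap, of u v] by (simp add: inner_commute)

text \<open>Differentiate the conormality relation \<open>DA_B\<close>.\<close>

lemma DDA_B:
  assumes "u \<in> U" shows "\<D> (\<lambda>a. \<D> A a w) u v \<bullet> B u = - (\<D> A u w \<bullet> \<D> B u v)"
proof -
  have "((\<lambda>a. \<D> A a w \<bullet> B a) has_derivative
      (\<lambda>v. \<D> A u w \<bullet> \<D> B u v + \<D> (\<lambda>a. \<D> A a w) u v \<bullet> B u)) (at u)"
    by (intro has_derivative_inner deriv_DA deriv_B assms)
  moreover have "((\<lambda>a. \<D> A a w \<bullet> B a) has_derivative (\<lambda>_. 0)) (at u)"
    by (rule has_derivative_transform_within_open[OF has_derivative_const open_U assms]) (simp add: DA_B)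
  ultimately have "(\<lambda>v. \<D> A u w \<bullet> \<D> B u v + \<D> (\<lambda>a. \<D> A a w) u v \<bullet> B u) = (\<lambda>_. 0)"
    by (rule has_derivative_unique)
  from fun_cong[OF this, of v] show ?thesis by simp
qed

text \<open>By \<open>DDA_B\<close> the pairing of the two derivatives is minus the conormal component of the second
  derivative of \<open>A\<close>. It will be minus the metric, whose symmetry thus comes from that of second
  derivatives.\<close>

lemma cross_symmetric:
  assumes "u \<in> U" shows "\<D> A u v \<bullet> \<D> B u w = \<D> A u w \<bullet> \<D> B u v"
  using DDA_B[OF assms, of v w] DDA_B[OF assms, of w v]
    second_derivative_symmetric[OF open_U assms smooth_A, of v w] by simp

end

locale dual_immersions = paired_maps A B U
  for A B :: "real^'m \<Rightarrow> 'v::euclidean_space" and U +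
  assumes nondegenerate: "\<And>u v. u \<in> U \<Longrightarrow> v \<noteq> 0 \<Longrightarrow> \<D> A u v \<bullet> \<D> B u v \<noteq> 0"
    and dim_ambient: "DIM('v) = CARD('m) + 1"
begin

lemma swap_dual: "dual_immersions B A U"
proof -
  interpret s: paired_maps B A U by (rule swap)
  show ?thesis using nondegenerate dim_ambient by unfold_locales (auto simp: inner_commute)
qed

lemma diff_A: "u \<in> U \<Longrightarrow> A differentiable at u" and diff_B: "u \<in> U \<Longrightarrow> B differentiable at u"
  by (auto intro: Cinf_on_differentiable smooth_A smooth_B open_U)

text \<open>Nondegeneracy makes the conormal vector and its derivatives linearly independent, and their number
  is the dimension of the ambient space. This is where the count of dimensions enters: it allows a
  vector to be identified by its pairings with the conormal frame.\<close>

lemma coframe_spans: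
  assumes u: "u \<in> U" and 0: "z \<bullet> B u = 0" and D: "\<And>v. z \<bullet> \<D> B u v = 0"
  shows "z = 0"
proof -
  let ?L = "\<lambda>(v, s). \<D> B u v + s *\<^sub>R B u"
  have lin: "linear ?L"
    by (rule linearI) (auto simp: D_linear[OF diff_B[OF u]] algebra_simps)
  have "inj ?L"
    unfolding linear_injective_0[OF lin]
  proof (intro allI impI)
    fix p assume p: "?L p = 0"
    obtain v s where [simp]: "p = (v, s)" by (cases p)
    \<comment> \<open>Pairing with \<open>A u\<close> isolates the conormal coefficient; nondegeneracy then removes the rest.\<close>
    have "A u \<bullet> ?L p = s" by (simp add: inner_add_right A_DB pair_diag u)
    then have "s = 0" using p by simp
    then have "\<D> A u v \<bullet> \<D> B u v = 0" using p by simp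
    then show "p = 0" using nondegenerate[OF u] \<open>s = 0\<close> by (auto simp: zero_prod_def)
  qed
  then have "dim (range ?L) = DIM((real^'m) \<times> real)"
    using dim_image_eq[OF lin, of UNIV] by simp
  then have "dim (range ?L) = DIM('v)" using dim_ambient by simp
  then have "span (range ?L) = UNIV" by (simp add: dim_eq_full)
  then have "range ?L = UNIV"
    using span_eq_iff linear_subspace_image[OF lin subspace_UNIV] by metis
  then have "z \<in> range ?L" by simp
  then obtain v s where "z = \<D> B u v + s *\<^sub>R B u" by auto
  then have "z \<bullet> z = z \<bullet> (\<D> B u v + s *\<^sub>R B u)" by simp
  then show ?thesis using 0 D by (simp add: inner_add_right)
qed

lemma DA_inj:
  assumes "u \<in> U" "\<And>w. \<D> A u v \<bullet> \<D> B u w = 0"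
  shows "v = 0"
  using nondegenerate assms by blast

lemma metric_det_nonzero:
  assumes u: "u \<in> U"
  shows "det (\<chi> i j. \<D> A u (axis j 1) \<bullet> \<D> B u (axis i 1)) \<noteq> 0" (is "det ?M \<noteq> 0")
proof -
  have M: "(?M *v v) $ i = \<D> A u v \<bullet> \<D> B u (axis i 1)" for v i
    by (subst D_axis_expand[OF diff_A[OF u], of v])
      (simp add: matrix_vector_mult_def inner_sum_left mult.commute)
  have "v = 0" if "?M *v v = 0" for v
  proof (rule DA_inj[OF u])
    fix w
    have "\<D> A u v \<bullet> \<D> B u (axis i 1) = 0" for i using M[of v i] that by simp
    then show "\<D> A u v \<bullet> \<D> B u w = 0"
      by (subst D_axis_expand[OF diff_B[OF u], of w]) (simp add: inner_sum_right)
  qed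
  then show ?thesis
    using matrix_left_invertible_ker[of ?M] invertible_left_inverse invertible_det_nz by blast
qed

end

text \<open>The condition says that the tangential part of the second derivatives of \<open>A\<close>, as seen by the
  derivatives of \<open>B\<close>, is given by the Christoffel symbols. This is what the lowered coefficients
  \<open>primal_coeff\<close> and \<open>dual_coeff\<close> amount to for a logarithmic pairing.\<close>

locale gauss_connection = dual_immersions A B U
  for A B :: "real^'m \<Rightarrow> 'v::euclidean_space" and U +
  fixes \<Gamma> :: "real^'m \<Rightarrow> 'm \<Rightarrow> 'm \<Rightarrow> 'm \<Rightarrow> real"
  assumes connection: "\<And>u i j m. u \<in> U \<Longrightarrow>
    (\<Sum>k\<in>UNIV. \<Gamma> u i j k * (\<D> A u (axis k 1) \<bullet> \<D> B u (axis m 1)))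
      = \<D> (\<lambda>a. \<D> A a (axis j 1)) u (axis i 1) \<bullet> \<D> B u (axis m 1)"
begin

lemma gauss_frame:
  assumes u: "u \<in> U"
  shows "\<D> (\<lambda>a. \<D> A a (axis j 1)) u (axis i 1) =
    \<D> A u (\<chi> k. \<Gamma> u i j k) - (\<D> A u (axis i 1) \<bullet> \<D> B u (axis j 1)) *\<^sub>R A u"
    (is "?lhs = ?rhs")
proof -
  have "?lhs - ?rhs = 0"
  proof (rule coframe_spans[OF u])
    show "(?lhs - ?rhs) \<bullet> B u = 0"
      by (simp add: inner_diff_left DDA_B[OF u] DA_B[OF u] pair_diag[OF u] cross_symmetric[OF u, of "axis i 1"])
    fix w
    have "(?lhs - ?rhs) \<bullet> \<D> B u (axis m 1) = 0" for m
      using connection[OF u, of i j m]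
      by (subst D_axis_expand[OF diff_A[OF u], of "\<chi> k. \<Gamma> u i j k"])
        (simp add: inner_diff_left inner_sum_left A_DB[OF u])
    then show "(?lhs - ?rhs) \<bullet> \<D> B u w = 0"
      by (subst D_axis_expand[OF diff_B[OF u], of w]) (simp add: inner_sum_right)
  qed
  then show ?thesis by simp
qed

text \<open>The Gauss formula of centroaffine geometry: the flat derivative of a tangential field splits into
  the tangential part, which is the covariant derivative, and a multiple of the position vector
  given by the second fundamental form, which here equals the metric.\<close>

lemma gauss_formula:
  assumes u: "u \<in> U" and Y: "Y differentiable at u"
  shows "\<D> (\<lambda>a. \<D> A a (Y a)) u (X u) =
    \<D> A u (covariant_deriv \<Gamma> X Y u) - (\<D> A u (X u) \<bullet> \<D> B u (Y u)) *\<^sub>R A u"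
proof -
  have dDA: "(\<lambda>a. \<D> A a w) differentiable at u" for w
    using deriv_DA[OF u] by (rule differentiableI)
  have 1: "\<D> (\<lambda>a. \<D> A a (Y u)) u (X u) =
     (\<Sum>i\<in>UNIV. \<Sum>j\<in>UNIV. (X u $ i * Y u $ j) *\<^sub>R \<D> (\<lambda>a. \<D> A a (axis j 1)) u (axis i 1))"
  proof -
    note sym = second_derivative_symmetric[OF open_U u smooth_A]
      and cong = sum.cong[OF refl arg_cong[where f = "(*\<^sub>R) _"]]
    have "\<D> (\<lambda>a. \<D> A a (Y u)) u (X u) = (\<Sum>i\<in>UNIV. (X u $ i) *\<^sub>R \<D> (\<lambda>a. \<D> A a (Y u)) u (axis i 1))"
      by (rule D_axis_expand[OF dDA])
    also have "\<dots> = (\<Sum>i\<in>UNIV. (X u $ i) *\<^sub>R \<D> (\<lambda>a. \<D> A a (axis i 1)) u (Y u))"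
      by (intro cong sym)
    also have "\<dots> = (\<Sum>i\<in>UNIV. (X u $ i) *\<^sub>R (\<Sum>j\<in>UNIV. (Y u $ j) *\<^sub>R \<D> (\<lambda>a. \<D> A a (axis i 1)) u (axis j 1)))"
      by (intro cong D_axis_expand[OF dDA])
    also have "\<dots> = (\<Sum>i\<in>UNIV. (X u $ i) *\<^sub>R (\<Sum>j\<in>UNIV. (Y u $ j) *\<^sub>R \<D> (\<lambda>a. \<D> A a (axis j 1)) u (axis i 1)))"
      by (intro cong sym)
    finally show ?thesis by (simp add: scaleR_right.sum)
  qed
  have 2: "\<D> A u (X u) \<bullet> \<D> B u (Y u) =
     (\<Sum>i\<in>UNIV. \<Sum>j\<in>UNIV. (X u $ i * Y u $ j) * (\<D> A u (axis i 1) \<bullet> \<D> B u (axis j 1)))"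
    by (subst D_axis_expand[OF diff_A[OF u], of "X u"], subst D_axis_expand[OF diff_B[OF u], of "Y u"])
       (simp add: inner_sum_left inner_sum_right sum_distrib_left mult_ac, rule sum.swap)
  show ?thesis
    unfolding D_eq[OF D_along_field[OF open_U u smooth_A Y]] 1 2 gauss_frame[OF u] covariant_deriv_eq[OF Y]
    by (simp add: D_linear[OF diff_A[OF u]] scaleR_diff_right sum_subtractf scaleR_left.sum)
qed

text \<open>Pairing the Gauss formula with the derivatives of \<open>B\<close> exhibits the covariant derivative as the
  solution of a linear system with smooth coefficients and nonvanishing determinant.\<close>

lemma covariant_deriv_differentiable:
  assumes Y: "Cinf_on Y U" and Z: "Cinf_on Z U" and u: "u \<in> U"
  shows "covariant_deriv \<Gamma> Y Z differentiable at u"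
proof (rule linear_system_solution_differentiable[OF open_U u])
  let ?r = "\<lambda>a. \<D> (\<lambda>a. \<D> A a (Z a)) a (Y a) + (\<D> A a (Y a) \<bullet> \<D> B a (Z a)) *\<^sub>R A a"
  let ?M = "\<lambda>a. \<chi> i j. \<D> A a (axis j 1) \<bullet> \<D> B a (axis i 1)"
  let ?b = "\<lambda>a. \<chi> i. ?r a \<bullet> \<D> B a (axis i 1)"
  note diff = Cinf_on_differentiable[OF _ open_U]
  show "?M a *v covariant_deriv \<Gamma> Y Z a = ?b a" if a: "a \<in> U" for a
  proof -
    have "?r a = \<D> A a (covariant_deriv \<Gamma> Y Z a)"
      using gauss_formula[OF a diff[OF Z a], of Y] by simp
    also have "\<dots> = (\<Sum>j\<in>UNIV. (covariant_deriv \<Gamma> Y Z a $ j) *\<^sub>R \<D> A a (axis j 1))"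
      by (rule D_axis_expand[OF diff_A[OF a]])
    finally show ?thesis
      by (simp only:) (simp add: vec_eq_iff matrix_vector_mult_def inner_sum_left mult.commute)
  qed
  show "det (?M a) \<noteq> 0" if "a \<in> U" for a by (rule metric_det_nonzero[OF that])
  have DAe: "(\<lambda>a. \<D> A a w) differentiable at u" and DBe: "(\<lambda>a. \<D> B a w) differentiable at u" for w
    using deriv_DA[OF u] deriv_DB[OF u] differentiableI by blast+
  show "(\<lambda>a. ?M a $ i $ j) differentiable at u" for i j
    by (simp add: DAe DBe)
  have "?r differentiable at u"
    by (intro differentiable_add differentiable_scaleR differentiable_inner diff[OF _ u]
        Cinf_on_D_field open_U smooth_A smooth_B Y Z)
  then show "(\<lambda>a. ?b a $ i) differentiable at u" for i
    by (simp add: DBe)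
qed

text \<open>Differentiate the Gauss formula once more and antisymmetrise. Since the ambient space is flat, the
  tangential part of the result, isolated by pairing with the derivatives of \<open>B\<close>, must vanish. Besides
  the curvature it contains the derivative of the position vector \<open>A\<close> in the normal part of the first
  derivative, namely the derivative of \<open>A\<close> along \<open>X\<close> weighted by the pairing of \<open>Y\<close> and \<open>Z\<close>; it is this
  term that produces constant curvature.\<close>

theorem curvature_eq:
  assumes X: "Cinf_on X U" and Y: "Cinf_on Y U" and Z: "Cinf_on Z U" and u: "u \<in> U"
  shows "curvature \<Gamma> X Y Z u =
    (\<D> A u (Y u) \<bullet> \<D> B u (Z u)) *\<^sub>R X u - (\<D> A u (X u) \<bullet> \<D> B u (Z u)) *\<^sub>R Y u"
proof -
  note diff = Cinf_on_differentiable[OF _ open_U]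
  let ?S = "\<lambda>a. \<D> A a (Z a)"
  let ?h = "\<lambda>X a. \<D> A a (X a) \<bullet> \<D> B a (Z a)"
  have S: "Cinf_on ?S U" by (intro Cinf_on_D_field open_U smooth_A Z)
  \<comment> \<open>The derivative of \<open>?h Y\<close> only contributes a multiple of \<open>A u\<close>, which is invisible to \<open>\<D> B u w\<close>.\<close>
  have twice: "\<D> (\<lambda>a. \<D> ?S a (Y a)) u (X u) \<bullet> \<D> B u w =
     \<D> A u (covariant_deriv \<Gamma> X (covariant_deriv \<Gamma> Y Z) u - ?h Y u *\<^sub>R X u) \<bullet> \<D> B u w"
    if Y: "Cinf_on Y U" for X Y w
  proof -
    let ?W = "covariant_deriv \<Gamma> Y Z"
    have W: "?W differentiable at u" by (rule covariant_deriv_differentiable[OF Y Z u])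
    have "?h Y differentiable at u"
      by (intro differentiable_inner diff[OF _ u] Cinf_on_D_field open_U smooth_A smooth_B Y Z)
    then have "((\<lambda>a. \<D> A a (?W a) - ?h Y a *\<^sub>R A a) has_derivative
        (\<lambda>v. \<D> (\<lambda>a. \<D> A a (?W a)) u v - (?h Y u *\<^sub>R \<D> A u v + \<D> (?h Y) u v *\<^sub>R A u))) (at u)"
      by (intro has_derivative_diff has_derivative_scaleR has_derivative_D diff_A u
          differentiableI[OF D_along_field[OF open_U u smooth_A W]])
    then have "((\<lambda>a. \<D> ?S a (Y a)) has_derivative
        (\<lambda>v. \<D> (\<lambda>a. \<D> A a (?W a)) u v - (?h Y u *\<^sub>R \<D> A u v + \<D> (?h Y) u v *\<^sub>R A u))) (at u)"
      by (rule has_derivative_transform_within_open[OF _ open_U u])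
        (simp add: gauss_formula[OF _ diff[OF Z]])
    then show ?thesis
      by (simp add: D_eq gauss_formula[OF u W] D_linear[OF diff_A[OF u]]
          inner_diff_left inner_add_left A_DB[OF u])
  qed
  have br: "\<D> ?S u (lie_bracket X Y u) \<bullet> \<D> B u w =
     \<D> A u (covariant_deriv \<Gamma> (lie_bracket X Y) Z u) \<bullet> \<D> B u w" for w
    using gauss_formula[OF u diff[OF Z u], of "lie_bracket X Y"] by (simp add: inner_diff_left A_DB[OF u])
  have "curvature \<Gamma> X Y Z u - (?h Y u *\<^sub>R X u - ?h X u *\<^sub>R Y u) = 0"
  proof (rule DA_inj[OF u])
    fix w
    have "(\<D> (\<lambda>a. \<D> ?S a (Y a)) u (X u) - \<D> (\<lambda>a. \<D> ?S a (X a)) u (Y u)) \<bullet> \<D> B u w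
       = \<D> ?S u (lie_bracket X Y u) \<bullet> \<D> B u w"
      by (simp only: mixed_derivative_commutator[OF open_U u S diff[OF X u] diff[OF Y u]])
    then show "\<D> A u (curvature \<Gamma> X Y Z u - (?h Y u *\<^sub>R X u - ?h X u *\<^sub>R Y u)) \<bullet> \<D> B u w = 0"
      unfolding inner_diff_left twice[OF X] twice[OF Y] br
      by (simp add: curvature_def D_linear[OF diff_A[OF u]] inner_diff_left)
  qed
  then show ?thesis by simp
qed

end


section \<open>The geometry induced by the logarithm of a pairing\<close>

text \<open>Raising an index with the inverse metric and then lowering it changes nothing.\<close>

lemma inverse_contraction:
  fixes G :: "real^'m^'m"
  assumes "invertible G"
  shows "(\<Sum>k\<in>UNIV. (\<Sum>l\<in>UNIV. c l * matrix_inv G $ l $ k) * G $ k $ m) = c m"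
proof -
  have inv: "matrix_inv G ** G = mat 1"
    using someI_ex[OF assms[unfolded invertible_def]] by (simp add: matrix_inv_def)
  have "(\<Sum>k\<in>UNIV. (\<Sum>l\<in>UNIV. c l * matrix_inv G $ l $ k) * G $ k $ m)
      = (\<Sum>l\<in>UNIV. c l * (matrix_inv G ** G) $ l $ m)"
    by (simp add: matrix_matrix_mult_def sum_distrib_left sum_distrib_right mult.assoc, rule sum.swap)
  also have "\<dots> = c m" by (simp add: inv mat_def if_distrib[of "(*) _"] cong: if_cong)
  finally show ?thesis .
qed

lemma dirderiv_quotient:
  assumes "(f has_derivative f') (at u)" "(g has_derivative g') (at u)" "g u \<noteq> (0::real)"
  shows "dirderiv (\<lambda>a. f a / g a) u v = (f' v * g u - f u * g' v) / (g u)\<^sup>2"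
  by (subst dirderiv_eq[OF has_derivative_divide'[OF assms]]) (simp add: power2_eq_square)

text \<open>Terms of a divergence that depend on one argument only do not affect mixed derivatives, and for an
  L-divergence such a term can be absorbed in the choice of \<open>A\<close> and \<open>B\<close>, leaving the logarithm of a
  bilinear pairing. On the diagonal the pairing is 1 and its first derivatives vanish, so only the
  leading term survives in each of the mixed derivatives below.\<close>

locale log_pairing = paired_maps A B U
  for A B :: "real^'m \<Rightarrow> 'v::euclidean_space" and U +
  fixes T :: "real^'m \<Rightarrow> real^'m \<Rightarrow> real"
  assumes T_eq: "\<And>a b. a \<in> U \<Longrightarrow> b \<in> U \<Longrightarrow> T a b = ln (A a \<bullet> B b)"
begin

lemma pair_pos: "a \<in> U \<Longrightarrow> b \<in> U \<Longrightarrow> 0 < A a \<bullet> B b"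
  using pair_ge[of a b] by simp

lemma dirderiv_T_second:
  assumes a: "a \<in> U" and b: "b \<in> U"
  shows "dirderiv (T a) b v = (A a \<bullet> \<D> B b v) / (A a \<bullet> B b)"
proof -
  have "dirderiv (T a) b v = dirderiv (\<lambda>b. ln (A a \<bullet> B b)) b v"
    by (rule dirderiv_cong[OF open_U b]) (simp add: T_eq a)
  also have "\<dots> = (A a \<bullet> \<D> B b v) / (A a \<bullet> B b)"
    by (rule dirderiv_eq) (auto intro!: derivative_eq_intros deriv_B simp: a b pair_pos field_simps)
  finally show ?thesis .
qed

lemma A_inner: "a \<in> U \<Longrightarrow> ((\<lambda>a. A a \<bullet> c) has_derivative (\<lambda>v. \<D> A a v \<bullet> c)) (at a)"
  and DA_inner: "a \<in> U \<Longrightarrow> ((\<lambda>a. \<D> A a w \<bullet> c) has_derivative (\<lambda>v. \<D> (\<lambda>a. \<D> A a w) a v \<bullet> c)) (at a)"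
  and B_inner: "a \<in> U \<Longrightarrow> ((\<lambda>a. c \<bullet> B a) has_derivative (\<lambda>v. c \<bullet> \<D> B a v)) (at a)"
  and DB_inner: "a \<in> U \<Longrightarrow> ((\<lambda>a. c \<bullet> \<D> B a w) has_derivative (\<lambda>v. c \<bullet> \<D> (\<lambda>a. \<D> B a w) a v)) (at a)"
  by (auto intro!: bounded_linear.has_derivative[OF bounded_linear_inner_left]
      bounded_linear.has_derivative[OF bounded_linear_inner_right] deriv_A deriv_B deriv_DA deriv_DB)

lemma metric_coeff_eq:
  assumes u: "u \<in> U"
  shows "metric_coeff T u i j = - (\<D> A u (axis i 1) \<bullet> \<D> B u (axis j 1))"
proof -
  have "pderiv_at i (\<lambda>a. pderiv_at j (T a) u) u =
      pderiv_at i (\<lambda>a. (A a \<bullet> \<D> B u (axis j 1)) / (A a \<bullet> B u)) u"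
    by (rule dirderiv_cong[OF open_U u]) (simp add: dirderiv_T_second u)
  then show ?thesis
    by (simp add: metric_coeff_def dirderiv_quotient[OF A_inner A_inner] u pair_diag A_DB)
qed

lemma primal_coeff_eq:
  assumes u: "u \<in> U"
  shows "primal_coeff T u i j k = - (\<D> (\<lambda>a. \<D> A a (axis j 1)) u (axis i 1) \<bullet> \<D> B u (axis k 1))"
proof -
  let ?c = "\<D> B u (axis k 1)" and ?d = "B u"
  let ?N = "\<lambda>a. (\<D> A a (axis j 1) \<bullet> ?c) * (A a \<bullet> ?d) - (A a \<bullet> ?c) * (\<D> A a (axis j 1) \<bullet> ?d)"
  have "pderiv_at j (\<lambda>b. pderiv_at k (T b) u) a = ?N a / (A a \<bullet> ?d)\<^sup>2" if a: "a \<in> U" for a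
  proof -
    have "pderiv_at j (\<lambda>b. pderiv_at k (T b) u) a = pderiv_at j (\<lambda>b. (A b \<bullet> ?c) / (A b \<bullet> ?d)) a"
      by (rule dirderiv_cong[OF open_U a]) (simp add: dirderiv_T_second u)
    then show ?thesis
      using pair_pos[OF a u] by (simp add: dirderiv_quotient[OF A_inner A_inner] a)
  qed
  then have 1: "pderiv_at i (\<lambda>a. pderiv_at j (\<lambda>b. pderiv_at k (T b) u) a) u =
      pderiv_at i (\<lambda>a. ?N a / (A a \<bullet> ?d)\<^sup>2) u"
    by (rule dirderiv_cong[OF open_U u])
  have N: "(?N has_derivative (\<lambda>v. \<D> (\<lambda>a. \<D> A a (axis j 1)) u v \<bullet> ?c)) (at u)"
    by (rule has_derivative_eq_rhs, (rule has_derivative_diff has_derivative_mult A_inner DA_inner u)+)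
       (simp add: pair_diag DA_B A_DB u)
  have d: "((\<lambda>a. (A a \<bullet> ?d)\<^sup>2) has_derivative (\<lambda>v. 0)) (at u)"
    by (rule has_derivative_eq_rhs, (rule has_derivative_power A_inner u)+) (simp add: DA_B u)
  show ?thesis
    unfolding primal_coeff_def 1
    by (simp add: dirderiv_quotient[OF N d] pair_diag u)
qed

lemma dual_coeff_eq:
  assumes u: "u \<in> U"
  shows "dual_coeff T u i j k = - (\<D> A u (axis k 1) \<bullet> \<D> (\<lambda>a. \<D> B a (axis j 1)) u (axis i 1))"
proof -
  let ?d = "B u"
  let ?N = "\<lambda>a. (A a \<bullet> \<D> (\<lambda>a. \<D> B a (axis j 1)) u (axis i 1)) * (A a \<bullet> ?d)
                 - (A a \<bullet> \<D> B u (axis j 1)) * (A a \<bullet> \<D> B u (axis i 1))"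
  have "pderiv_at i (\<lambda>a'. pderiv_at j (T a) a') u = ?N a / (A a \<bullet> ?d)\<^sup>2" if a: "a \<in> U" for a
  proof -
    have "pderiv_at i (\<lambda>a'. pderiv_at j (T a) a') u =
        pderiv_at i (\<lambda>a'. (A a \<bullet> \<D> B a' (axis j 1)) / (A a \<bullet> B a')) u"
      by (rule dirderiv_cong[OF open_U u]) (simp add: dirderiv_T_second a)
    then show ?thesis
      using pair_pos[OF a u] by (simp add: dirderiv_quotient[OF DB_inner B_inner] u)
  qed
  then have 1: "pderiv_at k (\<lambda>a. pderiv_at i (\<lambda>a'. pderiv_at j (T a) a') u) u =
      pderiv_at k (\<lambda>a. ?N a / (A a \<bullet> ?d)\<^sup>2) u"
    by (rule dirderiv_cong[OF open_U u])
  have N: "(?N has_derivative (\<lambda>v. \<D> A u v \<bullet> \<D> (\<lambda>a. \<D> B a (axis j 1)) u (axis i 1))) (at u)"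
    by (rule has_derivative_eq_rhs, (rule has_derivative_diff has_derivative_mult A_inner u)+)
       (simp add: pair_diag DA_B A_DB u)
  have d: "((\<lambda>a. (A a \<bullet> ?d)\<^sup>2) has_derivative (\<lambda>v. 0)) (at u)"
    by (rule has_derivative_eq_rhs, (rule has_derivative_power A_inner u)+) (simp add: DA_B u)
  show ?thesis
    unfolding dual_coeff_def 1
    by (simp add: dirderiv_quotient[OF N d] pair_diag u)
qed

lemma metric_form_eq:
  assumes u: "u \<in> U"
  shows "metric_form T X Y u = - (\<D> A u (X u) \<bullet> \<D> B u (Y u))"
proof -
  have d: "A differentiable at u" "B differentiable at u"
    using deriv_A[OF u] deriv_B[OF u] differentiableI by blast+
  have "\<D> A u (X u) \<bullet> \<D> B u (Y u) =
     (\<Sum>i\<in>UNIV. \<Sum>j\<in>UNIV. (\<D> A u (axis i 1) \<bullet> \<D> B u (axis j 1)) * X u $ i * Y u $ j)"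
    by (subst D_axis_expand[OF d(1), of "X u"], subst D_axis_expand[OF d(2), of "Y u"])
      (simp add: inner_sum_left inner_sum_right sum_distrib_left mult_ac, rule sum.swap)
  then show ?thesis by (simp add: metric_form_def metric_coeff_eq[OF u] sum_negf)
qed

end

locale log_pairing_geometry = dual_immersions A B U + log_pairing A B U T
  for A B :: "real^'m \<Rightarrow> 'v::euclidean_space" and U T
begin

lemma metric_invertible:
  assumes u: "u \<in> U"
  shows "invertible (\<chi> k l. metric_coeff T u k l)" (is "invertible ?G")
proof -
  have "v = 0" if "?G *v v = 0" for v
  proof -
    have "0 = v \<bullet> (?G *v v)" using that by simp
    also have "\<dots> = metric_form T (\<lambda>_. v) (\<lambda>_. v) u"
      by (simp add: metric_form_def inner_vec_def matrix_vector_mult_def sum_distrib_left mult_ac)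
    finally show ?thesis using nondegenerate[OF u, of v] by (auto simp: metric_form_eq[OF u])
  qed
  then show ?thesis using matrix_left_invertible_ker[of ?G] invertible_left_inverse by blast
qed

lemma primal_gauss: "gauss_connection A B U (primal_christoffel T)"
proof
  fix u i j m assume u: "u \<in> U"
  show "(\<Sum>k\<in>UNIV. primal_christoffel T u i j k * (\<D> A u (axis k 1) \<bullet> \<D> B u (axis m 1)))
      = \<D> (\<lambda>a. \<D> A a (axis j 1)) u (axis i 1) \<bullet> \<D> B u (axis m 1)"
    using inverse_contraction[OF metric_invertible[OF u], of "primal_coeff T u i j" m]
    by (simp add: primal_christoffel_def inverse_metric_coeff_def metric_coeff_eq[OF u]
        primal_coeff_eq[OF u] sum_negf)
qed

text \<open>The same argument with the roles of \<open>A\<close> and \<open>B\<close> exchanged; the metric is the same for both by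
  \<open>cross_symmetric\<close>.\<close>

lemma dual_gauss: "gauss_connection B A U (dual_christoffel T)"
proof -
  interpret s: dual_immersions B A U by (rule swap_dual)
  show ?thesis
  proof
    fix u i j m assume u: "u \<in> U"
    have "\<D> B u (axis k 1) \<bullet> \<D> A u (axis m 1) = - metric_coeff T u k m" for k
      using cross_symmetric[OF u, of "axis k 1" "axis m 1"] by (simp add: metric_coeff_eq[OF u] inner_commute)
    then show "(\<Sum>k\<in>UNIV. dual_christoffel T u i j k * (\<D> B u (axis k 1) \<bullet> \<D> A u (axis m 1)))
        = \<D> (\<lambda>a. \<D> B a (axis j 1)) u (axis i 1) \<bullet> \<D> A u (axis m 1)"
      using inverse_contraction[OF metric_invertible[OF u], of "dual_coeff T u i j" m]
      by (simp add: dual_christoffel_def inverse_metric_coeff_def dual_coeff_eq[OF u] sum_negf inner_commute)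
  qed
qed

theorem primal_constant_curvature: "constant_sectional_curvature U T (primal_christoffel T) (- 1)"
proof -
  interpret gauss_connection A B U "primal_christoffel T" by (rule primal_gauss)
  show ?thesis
    by (simp add: constant_sectional_curvature_def Cinf_on_iff_smooth_on[OF open_U] curvature_eq metric_form_eq)
qed

theorem dual_constant_curvature: "constant_sectional_curvature U T (dual_christoffel T) (- 1)"
proof -
  interpret d: gauss_connection B A U "dual_christoffel T" by (rule dual_gauss)
  have "\<D> B u v \<bullet> \<D> A u w = \<D> A u v \<bullet> \<D> B u w" if "u \<in> U" for u v w
    using cross_symmetric[OF that, of v w] by (simp add: inner_commute)
  then show ?thesis
    by (simp add: constant_sectional_curvature_def Cinf_on_iff_smooth_on[OF open_U] d.curvature_eq metric_form_eq)
qed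

end


section \<open>Ricci curvature of constant curvature connections\<close>

text \<open>Trace of \<open>v \<mapsto> c (g(Y,Z) v - g(v,Z) Y)\<close>: the identity contributes the dimension, and the trace of the
  rank-one map \<open>v \<mapsto> g(v,Z) Y\<close> is \<open>g(Y,Z)\<close>.\<close>

lemma ricci_constant_curvature:
  fixes Y Z :: "'m::finite vfield"
  assumes "constant_sectional_curvature U T \<Gamma> c" "open U" "smooth_on U Y" "smooth_on U Z" "u \<in> U"
  shows "ricci \<Gamma> Y Z u = c * (real CARD('m) - 1) * metric_form T Y Z u"
proof -
  have const: "smooth_on U (\<lambda>_. v)" for v :: "real^'m"
    unfolding Cinf_on_iff_smooth_on[OF assms(2)] by (simp add: Cinf_on_def)
  have R: "curvature \<Gamma> (\<lambda>_. v) Y Z u =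
      c *\<^sub>R (metric_form T Y Z u *\<^sub>R v - metric_form T (\<lambda>_. v) Z u *\<^sub>R Y u)" for v
    using assms const unfolding constant_sectional_curvature_def by blast
  have ax: "metric_form T (\<lambda>_. axis i 1) Z u = (\<Sum>j\<in>UNIV. metric_coeff T u i j * Z u $ j)" for i
  proof -
    have "metric_form T (\<lambda>_. axis i 1) Z u =
        (\<Sum>k\<in>UNIV. if k = i then \<Sum>j\<in>UNIV. metric_coeff T u k j * Z u $ j else 0)"
      unfolding metric_form_def by (intro sum.cong) (auto simp: axis_def)
    then show ?thesis by simp
  qed
  have "(\<Sum>i\<in>UNIV. metric_form T (\<lambda>_. axis i 1) Z u * Y u $ i) = metric_form T Y Z u"
    unfolding ax by (simp add: metric_form_def sum_distrib_left sum_distrib_right mult_ac)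
  then show ?thesis
    by (simp add: ricci_def trace_def matrix_def R sum_distrib_left[symmetric] sum_subtractf algebra_simps)
qed


section \<open>The simplex, its centroaffine lift and the conormal\<close>

lemma simplex_line_open:
  assumes "p \<in> prob_simplex" "(\<Sum>i\<in>UNIV. w $ i) = 0"
  shows "open {t. p + t *\<^sub>R w \<in> prob_simplex}"
proof -
  have "{t. p + t *\<^sub>R w \<in> prob_simplex} = (\<Inter>i. {t. 0 < p $ i + t * w $ i})"
    using assms by (auto simp: prob_simplex_def sum.distrib sum_distrib_left[symmetric])
  moreover have "open {t. 0 < p $ i + t * w $ i}" for i
    by (intro open_Collect_less continuous_intros)
  ultimately show ?thesis by (simp add: open_INT)
qed

lemma convex_prob_simplex: "convex prob_simplex"
proof (rule convexI)
  fix p q :: "real^'n" and s t :: real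
  assume *: "p \<in> prob_simplex" "q \<in> prob_simplex" "0 \<le> s" "0 \<le> t" "s + t = 1"
  have "0 < s * p $ i + t * q $ i" for i
  proof (cases "s = 0")
    case False
    then have "0 < s * p $ i" "0 \<le> t * q $ i" using * by (auto simp: prob_simplex_def less_imp_le)
    then show ?thesis by linarith
  qed (use * in \<open>auto simp: prob_simplex_def\<close>)
  then show "s *\<^sub>R p + t *\<^sub>R q \<in> prob_simplex"
    using * by (simp add: prob_simplex_def sum.distrib sum_distrib_left[symmetric])
qed

text \<open>A small segment through \<open>p\<close> in a tangential direction stays in the simplex, so the directional
  derivative does not see which local extension is used.\<close>

lemma dirderiv_on_simplex:
  assumes p: "p \<in> prob_simplex" and w: "(\<Sum>i\<in>UNIV. w $ i) = 0"
    and W: "open W" "p \<in> W" and G: "G differentiable at p"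
    and eq: "\<forall>q\<in>W \<inter> prob_simplex. G q = f q"
  shows "((\<lambda>t. f (p + t *\<^sub>R w)) has_real_derivative \<D> G p w) (at 0)"
    and "dirderiv f p w = \<D> G p w"
proof -
  have "((\<lambda>t. p + t *\<^sub>R w) has_derivative (\<lambda>t. t *\<^sub>R w)) (at 0)"
    by (auto intro!: derivative_eq_intros)
  moreover have "(G has_derivative \<D> G p) (at (p + 0 *\<^sub>R w))"
    using has_derivative_D[OF G] by simp
  ultimately have "((\<lambda>t. G (p + t *\<^sub>R w)) has_derivative (\<lambda>t. \<D> G p (t *\<^sub>R w))) (at 0)"
    by (rule has_derivative_compose)
  moreover have "\<D> G p (t *\<^sub>R w) = \<D> G p w * t" for t by (simp add: D_linear[OF G])
  ultimately have 1: "((\<lambda>t. G (p + t *\<^sub>R w)) has_real_derivative \<D> G p w) (at 0)"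
    by (simp add: has_field_derivative_def)
  let ?I = "{t. p + t *\<^sub>R w \<in> prob_simplex} \<inter> (\<lambda>t. p + t *\<^sub>R w) -` W"
  have "open ?I"
    by (intro open_Int simplex_line_open p w open_vimage W continuous_intros)
  moreover have "0 \<in> ?I" using p W by simp
  ultimately show 2: "((\<lambda>t. f (p + t *\<^sub>R w)) has_real_derivative \<D> G p w) (at 0)"
    using eq by (intro has_field_derivative_transform_within_open[OF 1]) auto
  then show "dirderiv f p w = \<D> G p w" by (simp add: dirderiv_def DERIV_imp_deriv)
qed

text \<open>Restrict to the line through \<open>p\<close> and \<open>q\<close>, where this is the tangent inequality for convex functions
  of one variable. The parameter interval is open because the simplex is relatively open, so \<open>p\<close>
  corresponds to an interior point.\<close>

lemma concave_below_tangent_on_simplex: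
  assumes f: "concave_on prob_simplex f"
    and p: "p \<in> prob_simplex" and q: "q \<in> prob_simplex"
    and W: "open W" "p \<in> W" and G: "G differentiable at p"
    and eq: "\<forall>q\<in>W \<inter> prob_simplex. G q = f q"
  shows "f q \<le> f p + dirderiv f p (q - p)"
proof -
  define w where "w = q - p"
  have w: "(\<Sum>i\<in>UNIV. w $ i) = 0"
    using p q by (simp add: w_def prob_simplex_def sum_subtractf)
  let ?I = "{t. p + t *\<^sub>R w \<in> prob_simplex}"
  let ?g = "\<lambda>t. - f (p + t *\<^sub>R w)"
  have line: "p + (s * a + t * b) *\<^sub>R w = s *\<^sub>R (p + a *\<^sub>R w) + t *\<^sub>R (p + b *\<^sub>R w)"
    if "s + t = 1" for s t a b :: real
  proof -
    have "s *\<^sub>R (p + a *\<^sub>R w) + t *\<^sub>R (p + b *\<^sub>R w) = (s + t) *\<^sub>R p + (s * a + t * b) *\<^sub>R w"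
      by (simp add: algebra_simps)
    then show ?thesis using that by simp
  qed
  have "convex ?I"
  proof (rule convexI)
    fix a b s t :: real assume *: "a \<in> ?I" "b \<in> ?I" "0 \<le> s" "0 \<le> t" "s + t = 1"
    have "s *\<^sub>R (p + a *\<^sub>R w) + t *\<^sub>R (p + b *\<^sub>R w) \<in> prob_simplex"
      by (rule convexD[OF convex_prob_simplex]) (use * in simp_all)
    then show "s *\<^sub>R a + t *\<^sub>R b \<in> ?I"
      using line[OF *(5), of a b] by (simp only: mem_Collect_eq real_scaleR_def)
  qed
  have "convex_on ?I ?g"
  proof (rule convex_onI)
    fix t a b :: real assume *: "0 < t" "t < 1" "a \<in> ?I" "b \<in> ?I"
    have "- f ((1 - t) *\<^sub>R (p + a *\<^sub>R w) + t *\<^sub>R (p + b *\<^sub>R w))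
        \<le> (1 - t) * - f (p + a *\<^sub>R w) + t * - f (p + b *\<^sub>R w)"
      by (rule convex_onD[OF f[unfolded concave_on_def]]) (use * in simp_all)
    then show "?g ((1 - t) *\<^sub>R a + t *\<^sub>R b) \<le> (1 - t) * ?g a + t * ?g b"
      using line[of "1 - t" t a b] by (simp only: real_scaleR_def diff_add_cancel)
  qed fact
  moreover have "(?g has_real_derivative - dirderiv f p w) (at 0 within ?I)"
    unfolding dirderiv_on_simplex(2)[OF p w W G eq]
    by (rule has_field_derivative_at_within[OF DERIV_minus[OF dirderiv_on_simplex(1)[OF p w W G eq]]])
  moreover have "0 \<in> interior ?I"
    using simplex_line_open[OF p w] p by (simp add: interior_open)
  moreover have "1 \<in> ?I" using q by (simp add: w_def)
  ultimately have "- dirderiv f p w * (1 - 0) \<le> ?g 1 - ?g 0"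
    by (intro convex_on_imp_above_tangent[OF _ convex_connected[OF \<open>convex ?I\<close>]])
  then show ?thesis by (simp add: w_def)
qed

text \<open>The point on the ray through \<open>p\<close> at which the extension of \<open>exp \<phi>\<close> to the positive cone, homogeneous
  of degree 1, takes the value 1.\<close>

definition centroaffine_lift :: "(real^'n \<Rightarrow> real) \<Rightarrow> real^'n \<Rightarrow> real^'n" where
  "centroaffine_lift \<phi> p = exp (- \<phi> p) *\<^sub>R p"

text \<open>The linear functional which on the simplex agrees with the first-order Taylor polynomial of
  \<open>exp \<phi>\<close> at \<open>p\<close>; its components are the values of that polynomial at the vertices. Only tangential
  derivatives of \<open>\<phi>\<close> occur, so no extension of \<open>\<phi>\<close> beyond the simplex has to be chosen.\<close>

definition conormal :: "(real^'n \<Rightarrow> real) \<Rightarrow> real^'n \<Rightarrow> real^'n" where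
  "conormal \<phi> p = (\<chi> i. exp (\<phi> p) * (1 + dirderiv \<phi> p (axis i 1 - p)))"

lemma simplex_axis: "p \<in> prob_simplex \<Longrightarrow> (\<Sum>j\<in>UNIV. (axis i 1 - p) $ j) = 0"
  by (simp add: prob_simplex_def sum_subtractf axis_def)

context
  fixes \<phi> :: "real^'n \<Rightarrow> real"
  assumes smooth_phi: "smooth_on prob_simplex \<phi>"
begin

lemma conormal_inner:
  assumes p: "p \<in> prob_simplex"
  shows "conormal \<phi> p \<bullet> w =
    exp (\<phi> p) * ((\<Sum>i\<in>UNIV. w $ i) + dirderiv \<phi> p (w - (\<Sum>i\<in>UNIV. w $ i) *\<^sub>R p))"
proof -
  obtain W \<Phi> where W: "open W" "p \<in> W" "Cinf_on \<Phi> W" "\<forall>q\<in>W \<inter> prob_simplex. \<Phi> q = \<phi> q"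
    using smooth_on_ext[OF smooth_phi p] by blast
  have d: "\<Phi> differentiable at p" using Cinf_on_differentiable W by blast
  note dd = dirderiv_on_simplex(2)[OF p _ W(1,2) d W(4)]
  let ?s = "\<Sum>i\<in>UNIV. w $ i"
  have t: "(\<Sum>i\<in>UNIV. (w - ?s *\<^sub>R p) $ i) = 0"
    using p by (simp add: prob_simplex_def sum_subtractf sum_distrib_left[symmetric])
  have e: "w - ?s *\<^sub>R p = (\<Sum>i\<in>UNIV. (w $ i) *\<^sub>R (axis i 1 - p))"
    using basis_expansion[of w]
    by (simp add: scalar_mult_eq_scaleR scaleR_diff_right sum_subtractf scaleR_left.sum)
  have "conormal \<phi> p \<bullet> w = (\<Sum>i\<in>UNIV. exp (\<phi> p) * (w $ i + w $ i * \<D> \<Phi> p (axis i 1 - p)))"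
    by (simp add: conormal_def inner_vec_def dd[OF simplex_axis[OF p]] algebra_simps)
  also have "\<dots> = exp (\<phi> p) * (?s + \<D> \<Phi> p (\<Sum>i\<in>UNIV. (w $ i) *\<^sub>R (axis i 1 - p)))"
    by (simp add: D_linear(3,4)[OF d] sum_distrib_left[symmetric] sum.distrib)
  finally show ?thesis unfolding dd[OF t] unfolding e .
qed

lemma smooth_centroaffine_lift: "smooth_on prob_simplex (centroaffine_lift \<phi>)"
  unfolding smooth_on_def
proof
  fix p assume p: "p \<in> (prob_simplex :: (real^'n) set)"
  obtain W \<Phi> where W: "open W" "p \<in> W" "Cinf_on \<Phi> W" "\<forall>q\<in>W \<inter> prob_simplex. \<Phi> q = \<phi> q"
    using smooth_on_ext[OF smooth_phi p] by blast
  have "Cinf_on (\<lambda>q. exp (- \<Phi> q) *\<^sub>R q) W"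
    by (intro Cinf_on_scaleR Cinf_on_exp Cinf_on_uminus Cinf_on_ident W)
  then show "\<exists>W F. open W \<and> p \<in> W \<and> (\<forall>k. Ck_on k F W) \<and> (\<forall>q\<in>W \<inter> prob_simplex. F q = centroaffine_lift \<phi> q)"
    using W by (intro exI[of _ W] exI[of _ "\<lambda>q. exp (- \<Phi> q) *\<^sub>R q"]) (auto simp: Cinf_on_def centroaffine_lift_def)
qed

lemma smooth_conormal: "smooth_on prob_simplex (conormal \<phi>)"
  unfolding smooth_on_def
proof
  fix p assume p: "p \<in> (prob_simplex :: (real^'n) set)"
  obtain W \<Phi> where W: "open W" "p \<in> W" "Cinf_on \<Phi> W" "\<forall>q\<in>W \<inter> prob_simplex. \<Phi> q = \<phi> q"
    using smooth_on_ext[OF smooth_phi p] by blast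
  let ?F = "\<lambda>q. \<chi> i. exp (\<Phi> q) * (1 + \<D> \<Phi> q (axis i 1 - q))"
  have "Cinf_on ?F W"
    by (intro Cinf_on_vec Cinf_on_mult Cinf_on_exp Cinf_on_add Cinf_on_const Cinf_on_D_field
        Cinf_on_diff Cinf_on_ident W)
  moreover have "?F q = conormal \<phi> q" if q: "q \<in> W" "q \<in> prob_simplex" for q
    using dirderiv_on_simplex(2)[OF q(2) simplex_axis[OF q(2)] W(1) q(1) Cinf_on_differentiable[OF W(3,1) q(1)] W(4)]
    using W(4) q by (simp add: conormal_def)
  ultimately show "\<exists>W F. open W \<and> p \<in> W \<and> (\<forall>k. Ck_on k F W) \<and> (\<forall>q\<in>W \<inter> prob_simplex. F q = conormal \<phi> q)"
    using W(1,2) by (intro exI[of _ W] exI[of _ ?F]) (auto simp: Cinf_on_def)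
qed

text \<open>The right-hand side is the exponential of $T(p \mid q)$ as soon as its last factor is positive.\<close>

lemma lift_conormal_pairing:
  assumes p: "p \<in> prob_simplex" and q: "q \<in> prob_simplex"
  shows "centroaffine_lift \<phi> p \<bullet> conormal \<phi> q = exp (\<phi> q - \<phi> p) * (1 + dirderiv \<phi> q (p - q))"
proof -
  have "conormal \<phi> q \<bullet> p = exp (\<phi> q) * (1 + dirderiv \<phi> q (p - q))"
    using conormal_inner[OF q, of p] p by (simp add: prob_simplex_def)
  then show ?thesis
    by (simp add: centroaffine_lift_def inner_commute exp_diff exp_minus field_simps)
qed

lemma lift_conormal_pairing_diag:
  "p \<in> prob_simplex \<Longrightarrow> centroaffine_lift \<phi> p \<bullet> conormal \<phi> p = 1"
  by (simp add: lift_conormal_pairing dirderiv_def)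

lemma dirderiv_exp_phi:
  assumes p: "p \<in> prob_simplex" and w: "(\<Sum>i\<in>UNIV. w $ i) = 0"
  shows "dirderiv (\<lambda>p. exp (\<phi> p)) p w = exp (\<phi> p) * dirderiv \<phi> p w"
proof -
  obtain W \<Phi> where W: "open W" "p \<in> W" "Cinf_on \<Phi> W" "\<forall>q\<in>W \<inter> prob_simplex. \<Phi> q = \<phi> q"
    using smooth_on_ext[OF smooth_phi p] by blast
  have d: "\<Phi> differentiable at p" using Cinf_on_differentiable W by blast
  have hd: "((\<lambda>q. exp (\<Phi> q)) has_derivative (\<lambda>v. exp (\<Phi> p) * \<D> \<Phi> p v)) (at p)"
    by (auto intro!: derivative_eq_intros has_derivative_D d)
  have "dirderiv (\<lambda>p. exp (\<phi> p)) p w = \<D> (\<lambda>q. exp (\<Phi> q)) p w"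
    by (rule dirderiv_on_simplex(2)[OF p w W(1,2) differentiableI[OF hd]]) (use W(4) in auto)
  also have "\<dots> = exp (\<Phi> p) * \<D> \<Phi> p w" by (simp add: D_eq[OF hd])
  finally have "dirderiv (\<lambda>p. exp (\<phi> p)) p w = exp (\<Phi> p) * \<D> \<Phi> p w" .
  then show ?thesis
    using dirderiv_on_simplex(2)[OF p w W(1,2) d W(4)] W(2,4) p by simp
qed

text \<open>Exponential concavity is used here: the graph of \<open>exp \<phi>\<close> lies below its tangent plane at \<open>q\<close>. In
  particular the argument of the logarithm in the L-divergence is positive everywhere.\<close>

lemma lift_conormal_pairing_ge:
  assumes conc: "exponentially_concave \<phi>" and p: "p \<in> prob_simplex" and q: "q \<in> prob_simplex"
  shows "1 \<le> centroaffine_lift \<phi> p \<bullet> conormal \<phi> q"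
proof -
  obtain W \<Phi> where W: "open W" "q \<in> W" "Cinf_on \<Phi> W" "\<forall>q\<in>W \<inter> prob_simplex. \<Phi> q = \<phi> q"
    using smooth_on_ext[OF smooth_phi q] by blast
  have d: "(\<lambda>q. exp (\<Phi> q)) differentiable at q"
    by (rule Cinf_on_differentiable[OF Cinf_on_exp[OF W(1,3)] W(1,2)])
  have "exp (\<phi> p) \<le> exp (\<phi> q) + dirderiv (\<lambda>p. exp (\<phi> p)) q (p - q)"
    by (rule concave_below_tangent_on_simplex[OF conc[unfolded exponentially_concave_def] q p W(1,2) d])
       (use W(4) in auto)
  also have "\<dots> = exp (\<phi> q) * (1 + dirderiv \<phi> q (p - q))"
    using p q by (subst dirderiv_exp_phi) (auto simp: prob_simplex_def sum_subtractf algebra_simps)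
  finally show ?thesis
    by (simp add: lift_conormal_pairing[OF p q] exp_diff field_simps)
qed

lemma conormal_tangent_inner:
  assumes p: "p \<in> prob_simplex" and w: "(\<Sum>i\<in>UNIV. w $ i) = 0"
  shows "conormal \<phi> p \<bullet> w = dirderiv (\<lambda>p. exp (\<phi> p)) p w"
  using conormal_inner[OF p, of w] by (simp add: w dirderiv_exp_phi[OF p w])

text \<open>On tangential vectors the conormal is the differential of \<open>exp \<phi>\<close>, so its derivative is the Hessian.\<close>

lemma hessian_conormal:
  assumes p: "p \<in> prob_simplex" and w: "(\<Sum>i\<in>UNIV. w $ i) = 0" and v: "(\<Sum>i\<in>UNIV. v $ i) = 0"
    and W: "open W" "p \<in> W" "N differentiable at p" "\<forall>q\<in>W \<inter> prob_simplex. N q = conormal \<phi> q"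
  shows "hessian (\<lambda>p. exp (\<phi> p)) p v w = \<D> N p v \<bullet> w"
proof -
  have hd: "((\<lambda>q. N q \<bullet> w) has_derivative (\<lambda>v. \<D> N p v \<bullet> w)) (at p)"
    by (intro bounded_linear.has_derivative[OF bounded_linear_inner_left] has_derivative_D W)
  have "hessian (\<lambda>p. exp (\<phi> p)) p v w = \<D> (\<lambda>q. N q \<bullet> w) p v"
    unfolding hessian_def
    by (rule dirderiv_on_simplex(2)[OF p v W(1,2) differentiableI[OF hd]])
       (use W(4) conormal_tangent_inner w in auto)
  then show ?thesis by (simp add: D_eq[OF hd])
qed

end

text \<open>Differentiate \<open>\<xi> (x u) = u\<close>, using a smooth local extension of \<open>\<xi>\<close>.\<close>

lemma coordinate_map_immersion:
  fixes \<xi> :: "real^'n \<Rightarrow> real^'m"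
  assumes c: "coordinate_system V U \<xi> x" and u: "u \<in> U" and x: "Cinf_on x U" and 0: "\<D> x u v = 0"
  shows "v = 0"
proof -
  have U: "open U" and h: "homeomorphism V U \<xi> x" and "smooth_on V \<xi>"
    using c by (auto simp: coordinate_system_def)
  then have "x u \<in> V" using u by (auto simp: homeomorphism_def)
  then obtain W \<Xi> where W: "open W" "x u \<in> W" "Cinf_on \<Xi> W" "\<forall>q\<in>W \<inter> V. \<Xi> q = \<xi> q"
    using smooth_on_ext[OF \<open>smooth_on V \<xi>\<close>] by blast
  let ?N = "U \<inter> x -` W"
  have N: "open ?N"
    using continuous_open_preimage[OF Cinf_on_continuous[OF x] U W(1)] .
  have "((\<lambda>b. \<Xi> (x b)) has_derivative (\<lambda>v. \<D> \<Xi> (x u) (\<D> x u v))) (at u)"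
    by (rule has_derivative_compose[OF has_derivative_D[OF Cinf_on_differentiable[OF x U u]]
          has_derivative_D[OF Cinf_on_differentiable[OF W(3,1,2)]]])
  then have "((\<lambda>b. b) has_derivative (\<lambda>v. \<D> \<Xi> (x u) (\<D> x u v))) (at u)"
    by (rule has_derivative_transform_within_open[OF _ N])
       (use u W h in \<open>auto simp: homeomorphism_def\<close>)
  from fun_cong[OF has_derivative_unique[OF this has_derivative_ident], of v]
  have "\<D> \<Xi> (x u) (\<D> x u v) = v" by simp
  then show ?thesis
    using 0 D_linear(5)[OF Cinf_on_differentiable[OF W(3,1,2)]] by simp
qed

text \<open>It remains to verify nondegeneracy. The derivative of the lift along \<open>v\<close> is a positive multiple of
  the tangent vector \<open>\<D> x u v\<close> plus a multiple of the position vector, which the derivative of the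
  conormal annihilates. The pairing is therefore a positive multiple of the Hessian of \<open>exp \<phi>\<close> on that
  tangent vector; the latter is nonzero since \<open>x\<close> is an immersion.\<close>

theorem lift_conormal_geometry:
  fixes \<phi> :: "real^'n \<Rightarrow> real"
    and \<xi> :: "real^'n \<Rightarrow> real^'m" and x :: "real^'m \<Rightarrow> real^'n"
  assumes card: "CARD('n) = CARD('m) + 1"
    and phi: "smooth_on prob_simplex \<phi>"
    and conc: "exponentially_concave \<phi>"
    and neg: "neg_definite_hessian (\<lambda>p. exp (\<phi> p))"
    and c: "coordinate_system V U \<xi> x"
  shows "log_pairing_geometry (\<lambda>u. centroaffine_lift \<phi> (x u)) (\<lambda>u. conormal \<phi> (x u)) U
    (coord_divergence \<phi> x)"
proof -
  let ?A = "\<lambda>u. centroaffine_lift \<phi> (x u)" and ?B = "\<lambda>u. conormal \<phi> (x u)"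
  have U: "open U" and x: "Cinf_on x U"
    using c by (auto simp: coordinate_system_def Cinf_on_iff_smooth_on)
  have V: "V \<subseteq> prob_simplex"
    using c openin_subset[of "top_of_set prob_simplex" V] by (auto simp: coordinate_system_def)
  then have xp: "x ` U \<subseteq> prob_simplex"
    using c by (auto simp: coordinate_system_def homeomorphism_def)
  then have xu: "x u \<in> prob_simplex" if "u \<in> U" for u using that by blast
  interpret paired_maps ?A ?B U
  proof
    show "Cinf_on ?A U" "Cinf_on ?B U"
      by (rule smooth_on_compose[OF U _ x xp] smooth_centroaffine_lift smooth_conormal phi)+
  qed (use U xu lift_conormal_pairing_ge[OF phi conc] lift_conormal_pairing_diag[OF phi] in auto)
  show ?thesis
  proof
    show "DIM(real^'n) = CARD('m) + 1" by (simp add: card)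
  next
    fix a b assume a: "a \<in> U" and b: "b \<in> U"
    have pos: "0 < exp (\<phi> (x b) - \<phi> (x a)) * (1 + dirderiv \<phi> (x b) (x a - x b))"
      using pair_ge[OF a b] lift_conormal_pairing[OF phi xu[OF a] xu[OF b]] by simp
    then show "coord_divergence \<phi> x a b = ln (?A a \<bullet> ?B b)"
      unfolding lift_conormal_pairing[OF phi xu[OF a] xu[OF b]]
      by (simp add: coord_divergence_def L_divergence_def ln_mult zero_less_mult_iff)
  next
    fix u v assume u: "u \<in> U" and v: "v \<noteq> (0 :: real^'m)"
    let ?w = "\<D> x u v"
    have dx: "(x has_derivative \<D> x u) (at u)"
      by (rule has_derivative_D[OF Cinf_on_differentiable[OF x U u]])
    have w: "?w \<noteq> 0" using coordinate_map_immersion[OF c u x] v by blast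
    have sum_w: "(\<Sum>i\<in>UNIV. ?w $ i) = 0"
    proof -
      have "((\<lambda>a. \<Sum>i\<in>UNIV. x a $ i) has_derivative (\<lambda>v. \<Sum>i\<in>UNIV. \<D> x u v $ i)) (at u)"
        by (intro has_derivative_sum bounded_linear.has_derivative[OF bounded_linear_vec_nth] dx)
      moreover have "((\<lambda>a. \<Sum>i\<in>UNIV. x a $ i) has_derivative (\<lambda>v. 0)) (at u)"
        by (rule has_derivative_transform_within_open[OF has_derivative_const[of 1] U u])
           (use xu in \<open>auto simp: prob_simplex_def\<close>)
      ultimately have "(\<lambda>v. \<Sum>i\<in>UNIV. \<D> x u v $ i) = (\<lambda>v. 0)" by (rule has_derivative_unique)
      from fun_cong[OF this, of v] show ?thesis .
    qed
    obtain W N where W: "open W" "x u \<in> W" "Cinf_on N W"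
        "\<forall>q\<in>W \<inter> prob_simplex. N q = conormal \<phi> q"
      using smooth_on_ext[OF smooth_conormal[OF phi] xu[OF u]] by blast
    have dN: "N differentiable at (x u)" by (rule Cinf_on_differentiable[OF W(3,1,2)])
    have DB: "\<D> ?B u v = \<D> N (x u) ?w"
    proof -
      have "open (U \<inter> x -` W)"
        using continuous_open_preimage[OF Cinf_on_continuous[OF x] U W(1)] .
      then have "(?B has_derivative (\<lambda>v. \<D> N (x u) (\<D> x u v))) (at u)"
        by (rule has_derivative_transform_within_open[OF has_derivative_compose[OF dx has_derivative_D[OF dN]]])
           (use u W(2,4) xu in auto)
      then show ?thesis by (simp add: D_eq)
    qed
    have neg_w: "\<D> ?B u v \<bullet> ?w < 0"
      using hessian_conormal[OF phi xu[OF u] sum_w sum_w W(1,2) dN W(4)] neg w sum_w xu[OF u]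
      unfolding DB neg_definite_hessian_def by metis
    obtain r where DA: "\<D> ?A u v = exp (- \<phi> (x u)) *\<^sub>R ?w + r *\<^sub>R x u"
    proof -
      obtain W' \<Phi> where W': "open W'" "x u \<in> W'" "Cinf_on \<Phi> W'"
          "\<forall>q\<in>W' \<inter> prob_simplex. \<Phi> q = \<phi> q"
        using smooth_on_ext[OF phi xu[OF u]] by blast
      have N': "open (U \<inter> x -` W')"
        using continuous_open_preimage[OF Cinf_on_continuous[OF x] U W'(1)] .
      let ?s = "\<lambda>a. exp (- \<Phi> (x a))"
      have "((\<lambda>a. \<Phi> (x a)) has_derivative (\<lambda>v. \<D> \<Phi> (x u) (\<D> x u v))) (at u)"
        by (rule has_derivative_compose[OF dx has_derivative_D[OF Cinf_on_differentiable[OF W'(3,1,2)]]])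
      then obtain s' where "(?s has_derivative s') (at u)"
        using has_derivative_exp[OF has_derivative_minus] by blast
      from has_derivative_scaleR[OF this dx]
      have "(?A has_derivative (\<lambda>v. ?s u *\<^sub>R \<D> x u v + s' v *\<^sub>R x u)) (at u)"
        by (rule has_derivative_transform_within_open[OF _ N'])
           (use u W'(2,4) xu in \<open>auto simp: centroaffine_lift_def\<close>)
      then have "\<D> ?A u v = exp (- \<phi> (x u)) *\<^sub>R ?w + s' v *\<^sub>R x u"
        using W'(2,4) xu[OF u] by (simp add: D_eq)
      then show ?thesis by (rule that)
    qed
    have "x u \<bullet> \<D> ?B u v = 0"
      using A_DB[OF u, of v] by (simp add: centroaffine_lift_def)
    then have "\<D> ?A u v \<bullet> \<D> ?B u v = exp (- \<phi> (x u)) * (\<D> ?B u v \<bullet> ?w)"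
      unfolding DA by (simp add: inner_add_left inner_commute[of "\<D> ?B u v" ?w])
    then show "\<D> ?A u v \<bullet> \<D> ?B u v \<noteq> 0" using neg_w by simp
  qed
qed


section \<open>Constant curvature of the L-divergence\<close>

theorem corollary4p10:
  fixes \<phi> :: "real^'n \<Rightarrow> real"
    and \<xi> :: "real^'n \<Rightarrow> real^'m" and x :: "real^'m \<Rightarrow> real^'n"
    and V :: "(real^'n) set" and U :: "(real^'m) set"
    and T :: "real^'m \<Rightarrow> real^'m \<Rightarrow> real"
  assumes "CARD('n) \<ge> 2"
    and "CARD('n) = CARD('m) + 1"
    and "smooth_on prob_simplex \<phi>"
    and "exponentially_concave \<phi>"
    and "neg_definite_hessian (\<lambda>p. exp (\<phi> p))"
    and "coordinate_system V U \<xi> x"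
    and "T = coord_divergence \<phi> x"
  shows "constant_sectional_curvature U T (primal_christoffel T) (- 1) \<and>
    constant_sectional_curvature U T (dual_christoffel T) (- 1) \<and>
    (\<forall>Y Z. smooth_on U Y \<and> smooth_on U Z \<longrightarrow> (\<forall>u\<in>U.
       ricci (primal_christoffel T) Y Z u = ricci (dual_christoffel T) Y Z u \<and>
       ricci (dual_christoffel T) Y Z u = - (real CARD('n) - 2) * metric_form T Y Z u))"
proof -
  interpret log_pairing_geometry "\<lambda>u. centroaffine_lift \<phi> (x u)" "\<lambda>u. conormal \<phi> (x u)" U T
    unfolding assms(7) by (rule lift_conormal_geometry[OF assms(2-6)])
  note primal = primal_constant_curvature and dual = dual_constant_curvature
  have "real CARD('m) - 1 = real CARD('n) - 2" using assms(2) by simp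
  then show ?thesis
    using primal dual ricci_constant_curvature[OF primal open_U] ricci_constant_curvature[OF dual open_U]
    by simp
qed

end
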